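(* Let $\mathbf F=\mathrm{Span}\{F^{(1)},\dots,F^{(s)}\}$ be a space of skew endomorphisms of a finite-dimensional Euclidean space $\mathbf v$, and let $A_0$, $B_0$ be unit anticommutators with respect to $\mathbf F$. Then the orthogonal endomorphism $\sqrt D$, with $D$ derived from $A_0B_0^{-1}$, conjugates $B_0$ to an anticommutator $\sqrt D\,B_0\sqrt D^{-1}$ of $\mathbf F$ which is a $\sigma$-deformation of $A_0$. Thus any non-trivial $unit_{endo}$-deformation $\delta_{\mathbf F}:A_0\to B_0$ is equivalent to a $\sigma_{A_0}$-deformation. A continuous family of $unit_{endo}$-deformations is always trivial: if $A_u$ is a continuous family of unit anticommutators with respect to $\mathbf F$, then the endomorphism spaces $\mathbb RA_u\oplus\mathbf F$ are conjugate to each other, and therefore the corresponding metric groups are isometric.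
   Context: A unit anticommutator with respect to $\mathbf F$ is a skew endomorphism $A_0$ of $\mathbf v$ with $A_0^2=-\mathrm{id}$ and $A_0F=-FA_0$ for all $F\in\mathbf F$. The $unit_{endo}$-deformation $\delta_{\mathbf F}:A_0\to B_0$ is the linear map $\mathbb RA_0\oplus\mathbf F\to\mathbb RB_0\oplus\mathbf F$ with $A_0\mapsto B_0$ and $F\mapsto F$ for $F\in\mathbf F$. A $\sigma$-deformation of $A_0$ is $\sigma\circ A_0$, where $\sigma$ is an involutive orthogonal transformation of $\mathbf v$ commuting with $A_0$ and with all elements of $\mathbf F$; the $\sigma_{A_0}$-deformation of $\mathbb RA_0\oplus\mathbf F$ replaces $A_0$ by $\sigma A_0$ and keeps $\mathbf F$ unchanged. Deformations are equivalent if the resulting endomorphism spaces are conjugate by an orthogonal transformation of $\mathbf v$ with corresponding elements going to each other (elements of $\mathbf F$ being fixed). Definition of $D$: the endomorphism $E=A_0B_0^{-1}=-A_0B_0$ is the sum of its symmetric part and its skew part, which commute; in a common Jordan basis $E$ is block diagonal with blocks $E_a=\tilde S_a\begin{pmatrix}\cos\alpha_a&\sin\alpha_a\\-\sin\alpha_a&\cos\alpha_a\end{pmatrix}$, so that $E=\tilde S\circ D$ with $\tilde S$ symmetric and $D$ orthogonal. On the subspace $K=\ker[A_0,B_0]$, where $E$ is symmetric, one takes $E=\tilde S$ and $D=\mathrm{id}$; on $K^\perp$, $D$ is the rotation part with angles $\alpha_a\in(-\pi,\pi)$. The operator $\sqrt D$ is the orthogonal endomorphism with corresponding blocks $\begin{pmatrix}\cos(\alpha_a/2)&\sin(\alpha_a/2)\\-\sin(\alpha_a/2)&\cos(\alpha_a/2)\end{pmatrix}$.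 Metric groups: to an endomorphism space $J_{\mathbf z}$ (image of an injective linear map $J:\mathbf z\to\mathfrak{so}(\mathbf v)$, with $\mathbf z$ Euclidean) corresponds the 2-step nilpotent simply connected Lie group with Lie algebra $\mathbf n=\mathbf v\oplus\mathbf z$, $\mathbf z$ central, $\langle[X,Y],Z\rangle=\langle J_Z(X),Y\rangle$ for $X,Y\in\mathbf v$, with the left-invariant metric given by the inner product of $\mathbf n$ (on $\mathbf z$ the natural norm is $|Z|^2=-\mathrm{Tr}(J_Z^2)$). *)

theory Defs
  imports "HOL-Analysis.Analysis"
begin

section \<open>Endomorphisms of a Euclidean space\<close>

text \<open>A linear endomorphism of a finite-dimensional space is automatically bounded, so the
  endomorphisms of \<open>\<v>\<close> are rendered as bounded linear maps. This makes them a normed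
  vector space (linear spans, continuity of families).\<close>

type_synonym 'v endo = "'v \<Rightarrow>\<^sub>L 'v"

definition skew_endo :: "'v::euclidean_space endo \<Rightarrow> bool" where
  "skew_endo T \<longleftrightarrow> (\<forall>x y. T x \<bullet> y = - (x \<bullet> T y))"

definition symmetric_endo :: "'v::euclidean_space endo \<Rightarrow> bool" where
  "symmetric_endo T \<longleftrightarrow> (\<forall>x y. T x \<bullet> y = x \<bullet> T y)"

definition orthogonal_endo :: "'v::euclidean_space endo \<Rightarrow> bool" where
  "orthogonal_endo T \<longleftrightarrow> orthogonal_transformation (blinfun_apply T)"

definition endo_trace :: "'v::euclidean_space endo \<Rightarrow> real" where
  "endo_trace T = (\<Sum>b\<in>Basis. T b \<bullet> b)"

text \<open>Meaningful for bijective arguments only.\<close>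

definition endo_inv :: "'v::euclidean_space endo \<Rightarrow> 'v endo" where
  "endo_inv P = Blinfun (inv (blinfun_apply P))"

definition conj_endo :: "'v::euclidean_space endo \<Rightarrow> 'v endo \<Rightarrow> 'v endo" where
  "conj_endo P T = P o\<^sub>L T o\<^sub>L endo_inv P"


section \<open>Unit anticommutators and deformations\<close>

definition unit_anticommutator :: "'v::euclidean_space endo set \<Rightarrow> 'v endo \<Rightarrow> bool" where
  "unit_anticommutator F A \<longleftrightarrow>
     skew_endo A \<and> A o\<^sub>L A = - id_blinfun \<and> (\<forall>T\<in>F. A o\<^sub>L T = - (T o\<^sub>L A))"

text \<open>The space \<open>\<real>A \<oplus> F\<close>. If \<open>F\<close> is a linear space and \<open>A\<close> is a unit anticommutator with respect
  to \<open>F\<close>, the sum is direct: \<open>A \<in> F\<close> would give \<open>A\<^sup>2 = - A\<^sup>2\<close>.\<close>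

definition adjoin :: "'v::euclidean_space endo \<Rightarrow> 'v endo set \<Rightarrow> 'v endo set" where
  "adjoin A F = {c *\<^sub>R A + T | c T. T \<in> F}"

text \<open>The linear map \<open>\<real>A \<oplus> F \<rightarrow> \<real>B \<oplus> F\<close> with \<open>A \<mapsto> B\<close> which is the identity on \<open>F\<close>;
  its values outside \<open>\<real>A \<oplus> F\<close> are irrelevant.\<close>

definition deformation ::
    "'v::euclidean_space endo set \<Rightarrow> 'v endo \<Rightarrow> 'v endo \<Rightarrow> 'v endo \<Rightarrow> 'v endo" where
  "deformation F A B T = (THE W. \<exists>c. \<exists>G\<in>F. T = c *\<^sub>R A + G \<and> W = c *\<^sub>R B + G)"

text \<open>\<open>\<sigma> = id\<close> is allowed here.\<close>

definition admissible_involution ::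
    "'v::euclidean_space endo set \<Rightarrow> 'v endo \<Rightarrow> 'v endo \<Rightarrow> bool" where
  "admissible_involution F A \<sigma> \<longleftrightarrow>
     orthogonal_endo \<sigma> \<and> \<sigma> o\<^sub>L \<sigma> = id_blinfun \<and>
     \<sigma> o\<^sub>L A = A o\<^sub>L \<sigma> \<and> (\<forall>T\<in>F. \<sigma> o\<^sub>L T = T o\<^sub>L \<sigma>)"

definition sigma_deformation_of ::
    "'v::euclidean_space endo set \<Rightarrow> 'v endo \<Rightarrow> 'v endo \<Rightarrow> bool" where
  "sigma_deformation_of F A C \<longleftrightarrow> (\<exists>\<sigma>. admissible_involution F A \<sigma> \<and> C = \<sigma> o\<^sub>L A)"

text \<open>\<open>\<delta>\<close> and \<open>\<delta>'\<close> are deformations of the same endomorphism space \<open>J\<close>. The second conjunct says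
  that the conjugation carries \<open>\<delta> ` J\<close> onto \<open>\<delta>' ` J\<close> with corresponding elements going to each
  other.\<close>

definition equivalent_deformations ::
    "'v::euclidean_space endo set \<Rightarrow> 'v endo set \<Rightarrow>
     ('v endo \<Rightarrow> 'v endo) \<Rightarrow> ('v endo \<Rightarrow> 'v endo) \<Rightarrow> bool" where
  "equivalent_deformations F J \<delta> \<delta>' \<longleftrightarrow>
     (\<exists>P. orthogonal_endo P \<and> (\<forall>T\<in>J. conj_endo P (\<delta> T) = \<delta>' T) \<and>
          (\<forall>T\<in>F. conj_endo P T = T))"

definition trivial_deformation ::
    "'v::euclidean_space endo set \<Rightarrow> 'v endo \<Rightarrow> 'v endo \<Rightarrow> bool" where
  "trivial_deformation F A B \<longleftrightarrow>
     equivalent_deformations F (adjoin A F) (deformation F A B) (\<lambda>T. T)"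


section \<open>The rotation part \<open>D\<close> and its square root\<close>

definition orthonormal_planes ::
    "nat \<Rightarrow> (nat \<Rightarrow> 'v::euclidean_space) \<Rightarrow> (nat \<Rightarrow> 'v) \<Rightarrow> bool" where
  "orthonormal_planes m e f \<longleftrightarrow>
     (\<forall>i<m. \<forall>j<m. e i \<bullet> e j = (if i = j then 1 else 0) \<and>
                  f i \<bullet> f j = (if i = j then 1 else 0) \<and> e i \<bullet> f j = 0)"

text \<open>In the basis \<open>e i, f i\<close> of the \<open>i\<close>-th plane the map has the matrix with rows
  \<open>(cos \<alpha>, sin \<alpha>)\<close> and \<open>(- sin \<alpha>, cos \<alpha>)\<close>, acting on column vectors.\<close>

definition rotation_blocks ::
    "nat \<Rightarrow> (nat \<Rightarrow> 'v::euclidean_space) \<Rightarrow> (nat \<Rightarrow> 'v) \<Rightarrow> (nat \<Rightarrow> real) \<Rightarrow> 'v endo \<Rightarrow> bool" where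
  "rotation_blocks m e f \<alpha> D \<longleftrightarrow>
     (\<forall>i<m. D (e i) = cos (\<alpha> i) *\<^sub>R e i - sin (\<alpha> i) *\<^sub>R f i \<and>
            D (f i) = sin (\<alpha> i) *\<^sub>R e i + cos (\<alpha> i) *\<^sub>R f i) \<and>
     (\<forall>x. (\<forall>i<m. x \<bullet> e i = 0 \<and> x \<bullet> f i = 0) \<longrightarrow> D x = x)"

text \<open>The factor \<open>D\<close> of \<open>E = A B\<^sup>-\<^sup>1 = S \<circ> D\<close>. The planes of the block decomposition span the
  orthogonal complement of \<open>K = ker [A, B]\<close>; hence \<open>D = id\<close> and \<open>S = E\<close> on \<open>K\<close>. On \<open>K\<^sup>\<bottom>\<close> the
  symmetric factor is a positive scalar on each plane; as the angles range over all of
  \<open>(-\<pi>, \<pi>)\<close>, this sign convention is what makes \<open>D\<close> well defined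
  (a rotation by \<open>\<alpha>\<close> is also \<open>-1\<close> times a rotation by \<open>\<alpha> \<plusminus> \<pi>\<close>).\<close>

definition rotation_part :: "'v::euclidean_space endo \<Rightarrow> 'v endo \<Rightarrow> 'v endo" where
  "rotation_part A B =
     (THE D. \<exists>S m e f \<alpha> s.
        orthonormal_planes m e f \<and>
        span (e ` {..<m} \<union> f ` {..<m}) = orthogonal_comp {x. A (B x) - B (A x) = 0} \<and>
        (\<forall>i<m. - pi < \<alpha> i \<and> \<alpha> i < pi) \<and>
        rotation_blocks m e f \<alpha> D \<and>
        symmetric_endo S \<and>
        (\<forall>i<m. 0 < s i \<and> S (e i) = s i *\<^sub>R e i \<and> S (f i) = s i *\<^sub>R f i) \<and>
        A o\<^sub>L endo_inv B = S o\<^sub>L D)"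

definition rotation_sqrt :: "'v::euclidean_space endo \<Rightarrow> 'v endo" where
  "rotation_sqrt D =
     (THE R. \<exists>m e f \<alpha>.
        orthonormal_planes m e f \<and>
        (\<forall>i<m. - pi < \<alpha> i \<and> \<alpha> i < pi) \<and>
        rotation_blocks m e f \<alpha> D \<and>
        rotation_blocks m e f (\<lambda>i. \<alpha> i / 2) R)"


section \<open>Riemannian isometries between Euclidean spaces with variable metrics\<close>

primrec Ck_map :: "nat \<Rightarrow> ('m::euclidean_space \<Rightarrow> 'n::euclidean_space) \<Rightarrow> bool" where
  "Ck_map 0 \<phi> \<longleftrightarrow> continuous_on UNIV \<phi>"
| "Ck_map (Suc k) \<phi> \<longleftrightarrow>
     (\<forall>p. \<phi> differentiable (at p)) \<and> (\<forall>\<xi>. Ck_map k (\<lambda>p. frechet_derivative \<phi> (at p) \<xi>))"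

definition smooth_map :: "('m::euclidean_space \<Rightarrow> 'n::euclidean_space) \<Rightarrow> bool" where
  "smooth_map \<phi> \<longleftrightarrow> (\<forall>k. Ck_map k \<phi>)"

text \<open>\<open>g p\<close> is the inner product on the tangent space at \<open>p\<close>.\<close>

definition riemannian_isometry ::
    "('m::euclidean_space \<Rightarrow> 'm \<Rightarrow> 'm \<Rightarrow> real) \<Rightarrow> ('n::euclidean_space \<Rightarrow> 'n \<Rightarrow> 'n \<Rightarrow> real) \<Rightarrow>
     ('m \<Rightarrow> 'n) \<Rightarrow> bool" where
  "riemannian_isometry g h \<phi> \<longleftrightarrow>
     bij \<phi> \<and> smooth_map \<phi> \<and> smooth_map (inv \<phi>) \<and>
     (\<forall>p \<xi> \<eta>. h (\<phi> p) (frechet_derivative \<phi> (at p) \<xi>) (frechet_derivative \<phi> (at p) \<eta>) = g p \<xi> \<eta>)"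


section \<open>Metric two-step nilpotent groups\<close>

text \<open>\<open>J\<close> parametrizes the endomorphism space \<open>S\<close> by the Euclidean space \<open>\<z>\<close>.\<close>

definition parametrizes :: "('z::euclidean_space \<Rightarrow> 'v::euclidean_space endo) \<Rightarrow> 'v endo set \<Rightarrow> bool" where
  "parametrizes J S \<longleftrightarrow> linear J \<and> inj J \<and> range J = S \<and> (\<forall>Z. skew_endo (J Z))"

definition natural_norm :: "('z::euclidean_space \<Rightarrow> 'v::euclidean_space endo) \<Rightarrow> bool" where
  "natural_norm J \<longleftrightarrow> (\<forall>Z. (norm Z)\<^sup>2 = - endo_trace (J Z o\<^sub>L J Z))"

text \<open>The bracket \<open>\<v> \<times> \<v> \<rightarrow> \<z>\<close> of \<open>\<n> = \<v> \<oplus> \<z>\<close>.\<close>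

definition nil_bracket :: "('z::euclidean_space \<Rightarrow> 'v::euclidean_space endo) \<Rightarrow> 'v \<Rightarrow> 'v \<Rightarrow> 'z" where
  "nil_bracket J X Y = adjoint (\<lambda>Z. J Z X) Y"

lemma nil_bracket_inner:
  assumes "linear J"
  shows "nil_bracket J X Y \<bullet> Z = J Z X \<bullet> Y"
proof -
  have "linear (\<lambda>Z. J Z X)"
    using assms by (simp add: linear_iff blinfun.add_left blinfun.scaleR_left)
  from adjoint_works[OF this] show ?thesis
    by (simp add: nil_bracket_def inner_commute)
qed

text \<open>The simply connected group with Lie algebra \<open>\<n>\<close>, in exponential coordinates: the underlying
  manifold is \<open>\<v> \<oplus> \<z>\<close> and the product is given by the Baker-Campbell-Hausdorff formula
  \<open>p q = p + q + [p, q] / 2\<close>. The unit element is \<open>0\<close> and the inverse of \<open>p\<close> is \<open>- p\<close>.\<close>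

definition nil_mult ::
    "('z::euclidean_space \<Rightarrow> 'v::euclidean_space endo) \<Rightarrow> 'v \<times> 'z \<Rightarrow> 'v \<times> 'z \<Rightarrow> 'v \<times> 'z" where
  "nil_mult J p q =
     (fst p + fst q, snd p + snd q + (1/2) *\<^sub>R nil_bracket J (fst p) (fst q))"

text \<open>The left-invariant metric: tangent vectors at \<open>p\<close> are moved to the unit element by the
  differential of the left translation by \<open>p\<^sup>-\<^sup>1\<close>, and the inner product of \<open>\<n> = \<v> \<oplus> \<z>\<close>
  (orthogonal sum) is applied.\<close>

definition left_invariant_metric ::
    "('z::euclidean_space \<Rightarrow> 'v::euclidean_space endo) \<Rightarrow> 'v \<times> 'z \<Rightarrow> 'v \<times> 'z \<Rightarrow> 'v \<times> 'z \<Rightarrow> real" where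
  "left_invariant_metric J p \<xi> \<eta> =
     frechet_derivative (nil_mult J (- p)) (at p) \<xi> \<bullet> frechet_derivative (nil_mult J (- p)) (at p) \<eta>"

definition isometric_metric_groups ::
    "('y::euclidean_space \<Rightarrow> 'v::euclidean_space endo) \<Rightarrow> ('z::euclidean_space \<Rightarrow> 'v endo) \<Rightarrow> bool" where
  "isometric_metric_groups J J' \<longleftrightarrow>
     (\<exists>\<phi>. riemannian_isometry (left_invariant_metric J) (left_invariant_metric J') \<phi>)"

end

theory Submission
  imports Defs
begin

text \<open>The orthogonal map \<open>E = A B\<^sup>-\<^sup>1 = - A B\<close> commutes with \<open>F\<close>, and conjugation by \<open>A\<close> or \<open>B\<close>
  inverts it. On \<open>K = ker [A, B]\<close> it is a symmetric involution; on \<open>K\<^sup>\<bottom>\<close> it has no real eigenvalue,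
  so it is a sum of plane rotations there. As \<open>E\<close> is orthogonal, the positive scalars of the symmetric
  factor are all \<open>1\<close>: \<open>E = S D\<close>, where \<open>D\<close> is \<open>E\<close> on \<open>K\<^sup>\<bottom>\<close> and \<open>S\<close> is \<open>E\<close> on \<open>K\<close>, each extended by the
  identity. The root \<open>R\<close> of \<open>D\<close> with \<open>R + R\<^sup>T \<ge> 0\<close> is unique, hence commutes with \<open>F\<close> and satisfies
  \<open>R B R = B\<close>. Therefore \<open>R B R\<^sup>-\<^sup>1 = D B = S A\<close>, and \<open>S\<close> is the involution \<open>\<sigma>\<close>.

  If \<open>A\<close> and \<open>B\<close> have distance less than \<open>2\<close>, then \<open>-1\<close> is no eigenvalue of \<open>E\<close>, so \<open>S = id\<close> and the
  deformation is trivial; triviality is an equivalence relation, and connectedness does the rest.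
  A conjugation \<open>P\<close> of endomorphism spaces extends to a linear isometry \<open>P \<oplus> \<psi>\<close> of \<open>\<v> \<oplus> \<z>\<close> that is an
  isomorphism of the groups.\<close>


section \<open>Orthogonal endomorphisms\<close>

lemma linear_endo: "linear (blinfun_apply (T :: 'v::euclidean_space endo))"
  by (rule bounded_linear.linear[OF blinfun.bounded_linear_right])

lemma orthogonal_endo_iff_inner: "orthogonal_endo Q \<longleftrightarrow> (\<forall>x y. Q x \<bullet> Q y = x \<bullet> y)"
  by (auto simp: orthogonal_endo_def orthogonal_transformation_def linear_endo)

lemma orthogonal_endo_iff_norm: "orthogonal_endo Q \<longleftrightarrow> (\<forall>x. norm (Q x) = norm x)"
  by (auto simp: orthogonal_endo_def orthogonal_transformation linear_endo)

text \<open>The inverse of a bijective linear map is linear, hence bounded in finite dimension, so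
  \<open>Blinfun\<close> in \<open>endo_inv\<close> represents it faithfully.\<close>

lemma endo_inv_works:
  assumes "bij (blinfun_apply P)"
  shows "endo_inv P (P x) = x" and "P (endo_inv P x) = x"
proof -
  have "linear (inv (blinfun_apply P))"
    using assms linear_endo[of P] by (simp add: bij_is_inj linear_injective_left_inverse inj_linear_imp_inv_linear)
  then have "blinfun_apply (endo_inv P) = inv (blinfun_apply P)"
    by (simp add: endo_inv_def bounded_linear_Blinfun_apply linear_conv_bounded_linear)
  with assms show "endo_inv P (P x) = x" "P (endo_inv P x) = x"
    by (simp_all add: bij_is_inj bij_is_surj surj_f_inv_f)
qed

lemma bij_orthogonal_endo: "orthogonal_endo Q \<Longrightarrow> bij (blinfun_apply Q)"
  by (simp add: orthogonal_endo_def orthogonal_transformation_bij)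

lemma orthogonal_endo_inv_works:
  assumes "orthogonal_endo Q"
  shows "endo_inv Q (Q x) = x" and "Q (endo_inv Q x) = x"
  using endo_inv_works[OF bij_orthogonal_endo[OF assms]] by blast+

lemma endo_inv_eqI:
  fixes P G :: "'v::euclidean_space endo"
  assumes "\<And>x. P (G x) = x" "\<And>x. G (P x) = x"
  shows "endo_inv P = G"
proof -
  have "bij (blinfun_apply P)"
    using assms by (metis bijI')
  then show ?thesis
    by (metis assms(1) blinfun_eqI endo_inv_works(1))
qed

lemma orthogonal_endo_inv:
  assumes "orthogonal_endo Q" shows "orthogonal_endo (endo_inv Q)"
  using assms by (metis orthogonal_endo_iff_norm orthogonal_endo_inv_works(2))

lemma endo_inv_inv: "orthogonal_endo Q \<Longrightarrow> endo_inv (endo_inv Q) = Q"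
  by (simp add: endo_inv_eqI orthogonal_endo_inv_works)

lemma orthogonal_endo_compose:
  "orthogonal_endo P \<Longrightarrow> orthogonal_endo Q \<Longrightarrow> orthogonal_endo (P o\<^sub>L Q)"
  by (simp add: orthogonal_endo_iff_norm)

lemma endo_inv_compose:
  "orthogonal_endo P \<Longrightarrow> orthogonal_endo Q \<Longrightarrow> endo_inv (P o\<^sub>L Q) = endo_inv Q o\<^sub>L endo_inv P"
  by (simp add: endo_inv_eqI orthogonal_endo_inv_works)

lemma conj_endo_apply: "conj_endo P T x = P (T (endo_inv P x))"
  by (simp add: conj_endo_def)

lemma conj_endo_compose:
  "orthogonal_endo P \<Longrightarrow> orthogonal_endo Q \<Longrightarrow> conj_endo (P o\<^sub>L Q) T = conj_endo P (conj_endo Q T)"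
  by (auto intro!: blinfun_eqI simp: conj_endo_apply endo_inv_compose)

lemma conj_endo_inverse:
  "orthogonal_endo P \<Longrightarrow> conj_endo (endo_inv P) (conj_endo P T) = T"
  by (auto intro!: blinfun_eqI simp: conj_endo_apply endo_inv_inv orthogonal_endo_inv_works)

lemma conj_endo_linear:
  "conj_endo P (T + U) = conj_endo P T + conj_endo P U"
  "conj_endo P (c *\<^sub>R T) = c *\<^sub>R conj_endo P T"
  by (auto intro!: blinfun_eqI simp: conj_endo_apply blinfun.bilinear_simps)

text \<open>Composing with \<open>P\<close> on the right removes the inverse; the facts about the
  square root of \<open>D\<close> are obtained in this intertwining form.\<close>

lemma conj_endo_eq_iff:
  assumes "orthogonal_endo P"
  shows "conj_endo P T = U \<longleftrightarrow> P o\<^sub>L T = U o\<^sub>L P"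
proof -
  have "conj_endo P T = U \<longleftrightarrow> (\<forall>x. P (T (endo_inv P x)) = U x)"
    by (metis conj_endo_apply blinfun_eqI)
  also have "\<dots> \<longleftrightarrow> (\<forall>x. P (T x) = U (P x))"
    by (metis assms orthogonal_endo_inv_works)
  also have "\<dots> \<longleftrightarrow> P o\<^sub>L T = U o\<^sub>L P"
    by (metis blinfun_apply_blinfun_compose blinfun_eqI)
  finally show ?thesis .
qed


section \<open>Unit anticommutators and involutions\<close>

lemma unit_anticommutatorD:
  fixes A T :: "'v::euclidean_space endo"
  assumes A: "unit_anticommutator F A"
  shows "A x \<bullet> y = - (x \<bullet> A y)" and "A (A x) = - x" and "T \<in> F \<Longrightarrow> A (T x) = - T (A x)"
proof -
  show "A x \<bullet> y = - (x \<bullet> A y)"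
    using assms by (simp add: unit_anticommutator_def skew_endo_def)
  have "(A o\<^sub>L A) x = (- id_blinfun) x"
    using assms by (simp add: unit_anticommutator_def)
  then show "A (A x) = - x"
    by (simp add: blinfun.bilinear_simps)
  assume "T \<in> F"
  then have "(A o\<^sub>L T) x = (- (T o\<^sub>L A)) x"
    using assms by (simp add: unit_anticommutator_def)
  then show "A (T x) = - T (A x)"
    by (simp add: blinfun.bilinear_simps)
qed

lemma unit_anticommutatorI:
  fixes A :: "'v::euclidean_space endo" and F :: "'v endo set"
  assumes "\<And>x y. A x \<bullet> y = - (x \<bullet> A y)" "\<And>x. A (A x) = - x"
    and "\<And>T x. T \<in> F \<Longrightarrow> A (T x) = - T (A x)"
  shows "unit_anticommutator F A"
  using assms
  by (auto intro!: blinfun_eqI simp: unit_anticommutator_def skew_endo_def blinfun.bilinear_simps)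

lemma endo_inv_unit_anticommutator:
  assumes "unit_anticommutator F A" shows "endo_inv A = - A"
  using unit_anticommutatorD(2)[OF assms]
  by (intro endo_inv_eqI) (simp_all add: blinfun.bilinear_simps)

lemma unit_anticommutator_inner:
  assumes "unit_anticommutator F A" shows "A x \<bullet> A y = x \<bullet> y"
  by (simp add: unit_anticommutatorD[OF assms])

text \<open>For an involution, orthogonality and symmetry are the same condition: substitute
  \<open>S y\<close> for \<open>y\<close> in the invariance of the inner product.\<close>

lemma admissible_involution_iff:
  fixes A S :: "'v::euclidean_space endo" and F :: "'v endo set"
  shows
  "admissible_involution F A S \<longleftrightarrow> (\<forall>x y. S x \<bullet> y = x \<bullet> S y) \<and> (\<forall>x. S (S x) = x) \<and>
     (\<forall>x. S (A x) = A (S x)) \<and> (\<forall>T\<in>F. \<forall>x. S (T x) = T (S x))"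
proof -
  have eq: "U = V \<longleftrightarrow> (\<forall>x. U x = V x)" for U V :: "'v endo"
    by (metis blinfun_eqI)
  have "orthogonal_endo S \<longleftrightarrow> (\<forall>x y. S x \<bullet> y = x \<bullet> S y)" if "\<And>x. S (S x) = x"
    by (metis orthogonal_endo_iff_inner that)
  then show ?thesis
    by (auto simp: admissible_involution_def eq)
qed

lemma unit_anticommutator_involution:
  assumes "unit_anticommutator F A" "admissible_involution F A S"
  shows "unit_anticommutator F (S o\<^sub>L A)"
  using assms(2)[unfolded admissible_involution_iff]
  by (intro unit_anticommutatorI)
     (simp_all add: unit_anticommutatorD[OF assms(1)] blinfun.bilinear_simps)

text \<open>Makes the definite description in \<open>deformation\<close> single valued: a difference
  of coefficients could be divided out, putting \<open>A\<close> itself into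
  \<open>F\<close>.\<close>

lemma scaleR_add_unique:
  fixes A :: "'v::euclidean_space endo"
  assumes "subspace F" "unit_anticommutator F A" "G \<in> F" "G' \<in> F"
    and "c *\<^sub>R A + G = c' *\<^sub>R A + G'"
  shows "c = c' \<and> G = G'"
proof -
  have "c = c'"
  proof (rule ccontr)
    assume "c \<noteq> c'"
    moreover have "(c - c') *\<^sub>R A = G' - G"
      using assms(5) by (simp add: algebra_simps)
    ultimately have "A = (1 / (c - c')) *\<^sub>R (G' - G)"
      by (metis right_minus_eq scaleR_one scaleR_scaleR nonzero_eq_divide_eq)
    then have "A \<in> F"
      using assms by (simp add: subspace_diff subspace_scale)
    have "x = 0" for x :: 'v
    proof -
      have "x + x = 0"
        using unit_anticommutatorD(3)[OF assms(2) \<open>A \<in> F\<close>, of x]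
          unit_anticommutatorD(2)[OF assms(2), of x] by (simp, metis right_minus)
      then show ?thesis by (simp flip: scaleR_2)
    qed
    \<comment> \<open>A \<open>euclidean_space\<close> is never zero-dimensional, so not all vectors
      vanish.\<close>
    then show False
      using nonempty_Basis nonzero_Basis by blast
  qed
  then show ?thesis using assms(5) by simp
qed

lemma deformation_eq:
  assumes "subspace F" "unit_anticommutator F A" "G \<in> F"
  shows "deformation F A B (c *\<^sub>R A + G) = c *\<^sub>R B + G"
  unfolding deformation_def
proof (rule the_equality)
  show "\<exists>d. \<exists>G'\<in>F. c *\<^sub>R A + G = d *\<^sub>R A + G' \<and> c *\<^sub>R B + G = d *\<^sub>R B + G'"
    using assms(3) by blast
qed (use scaleR_add_unique[OF assms(1,2)] assms(3) in blast)


section \<open>Block decomposition into invariant planes\<close>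

text \<open>Rayleigh quotient argument: a maximizer of the quadratic form of \<open>M\<close> on the
  unit sphere of \<open>W\<close> is an eigenvector.\<close>

lemma symmetric_eigenvector:
  fixes M :: "'v::euclidean_space endo"
  assumes sym: "\<And>x y. M x \<bullet> y = x \<bullet> M y"
    and W: "subspace W" "M ` W \<subseteq> W" "W \<noteq> {0}"
  obtains x c where "x \<in> W" "norm x = 1" "M x = c *\<^sub>R x"
proof -
  let ?K = "W \<inter> sphere 0 1"
  have "compact ?K"
    by (simp add: closed_Int_compact closed_subspace W)
  moreover have "?K \<noteq> {}"
  proof -
    obtain w where "w \<in> W" "w \<noteq> 0"
      using W subspace_0 by blast
    then have "(1 / norm w) *\<^sub>R w \<in> ?K"
      using W by (simp add: subspace_scale)
    then show ?thesis by blast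
  qed
  moreover have "continuous_on ?K (\<lambda>x. M x \<bullet> x)"
    by (intro continuous_intros)
  ultimately have "\<exists>x\<in>?K. \<forall>y\<in>?K. M y \<bullet> y \<le> M x \<bullet> x"
    by (rule continuous_attains_sup)
  then obtain x where x: "x \<in> ?K" and max: "\<And>y. y \<in> ?K \<Longrightarrow> M y \<bullet> y \<le> M x \<bullet> x"
    by blast
  define c where "c = M x \<bullet> x"
  \<comment> \<open>By homogeneity, \<open>c id - M\<close> is a nonnegative form on
    \<open>W\<close>, and it vanishes at \<open>x\<close>.\<close>
  have le: "0 \<le> (c *\<^sub>R y - M y) \<bullet> y" if "y \<in> W" for y
  proof (cases "y = 0")
    case False
    then have "(1 / norm y) *\<^sub>R y \<in> ?K"
      using W that by (simp add: subspace_scale)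
    from max[OF this] have "M y \<bullet> y / (norm y)\<^sup>2 \<le> c"
      by (simp add: c_def blinfun.bilinear_simps power2_eq_square)
    with False show ?thesis
      by (simp add: inner_diff_left divide_simps dot_square_norm)
  qed simp
  define n where "n = c *\<^sub>R x - M x"
  have n: "n \<in> W"
    unfolding n_def using W x by (intro subspace_diff subspace_scale) auto
  have xx: "x \<bullet> x = 1"
    using x by (simp add: dot_square_norm)
  have nx: "n \<bullet> x = 0"
    by (simp add: n_def c_def inner_diff_left xx)
  define b where "b = (c *\<^sub>R n - M n) \<bullet> n"
  have b: "b \<ge> 0"
    unfolding b_def by (rule le[OF n])
  \<comment> \<open>The nonnegative form is evaluated at \<open>x + t n\<close>. It is minimal at
    \<open>t = 0\<close>, so its derivative there, \<open>2 (n \<bullet> n)\<close>, has to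
    vanish.\<close>
  have quad: "0 \<le> 2 * t * (n \<bullet> n) + t\<^sup>2 * b" for t
  proof -
    have "x + t *\<^sub>R n \<in> W"
      using x n W by (intro subspace_add subspace_scale) auto
    from le[OF this] have "0 \<le> (n + t *\<^sub>R (c *\<^sub>R n - M n)) \<bullet> (x + t *\<^sub>R n)"
      by (simp add: n_def blinfun.bilinear_simps algebra_simps)
    also have "\<dots> = t * (n \<bullet> n) + t * ((c *\<^sub>R n - M n) \<bullet> x) + t\<^sup>2 * b"
      by (simp add: inner_add_left inner_add_right nx b_def power2_eq_square algebra_simps)
    also have "(c *\<^sub>R n - M n) \<bullet> x = n \<bullet> n"
    proof -
      have "(c *\<^sub>R n - M n) \<bullet> x = n \<bullet> (c *\<^sub>R x - M x)"
        by (simp add: inner_diff_left inner_diff_right sym)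
      then show ?thesis by (simp add: n_def)
    qed
    finally show ?thesis by simp
  qed
  have "n \<bullet> n = 0"
  proof (rule ccontr)
    assume "n \<bullet> n \<noteq> 0"
    then have a: "n \<bullet> n > 0" by simp
    let ?a = "n \<bullet> n"
    \<comment> \<open>At \<open>t = - u\<close> the linear term outweighs the quadratic one; the
      \<open>+ 1\<close> keeps the quotient defined when \<open>b = 0\<close>.\<close>
    define u where "u = ?a / (b + 1)"
    have u: "?a = u * (b + 1)" "u > 0"
      using a b by (simp_all add: u_def)
    have "2 * (- u) * ?a + (- u)\<^sup>2 * b = - (u\<^sup>2 * (b + 2))"
      unfolding u(1) by (simp add: algebra_simps power2_eq_square)
    also have "\<dots> < 0"
      using u b by simp
    finally show False
      using quad[of "- u"] by simp
  qed
  then have "M x = c *\<^sub>R x"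
    by (simp add: n_def)
  with x that show thesis by auto
qed

lemma orthonormal_planesD:
  assumes "orthonormal_planes m e f" "i < m" "j < m"
  shows "e i \<bullet> e j = (if i = j then 1 else 0)" "f i \<bullet> f j = (if i = j then 1 else 0)"
    "e i \<bullet> f j = 0" "f i \<bullet> e j = 0"
  using assms by (auto simp: orthonormal_planes_def inner_commute)

text \<open>\<open>E\<close> is orthogonal with inverse \<open>G\<close>, and \<open>nr\<close>
  excludes the eigenvalues \<open>1\<close> and \<open>-1\<close> on \<open>W\<close>. An
  eigenvector \<open>x\<close> of the symmetric map \<open>E + G\<close> satisfies a quadratic
  equation under \<open>E\<close>, so \<open>x\<close> and \<open>E x\<close> span an invariant
  plane. Induction on the dimension treats its complement in \<open>W\<close>.\<close>

lemma invariant_plane_decomposition: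
  fixes E G :: "'v::euclidean_space endo"
  assumes adj: "\<And>x y. E x \<bullet> y = x \<bullet> G y"
    and inv: "\<And>x. E (G x) = x" "\<And>x. G (E x) = x"
    and W: "subspace W" "E ` W \<subseteq> W" "G ` W \<subseteq> W"
    and nr: "\<forall>x\<in>W. E (E x) = x \<longrightarrow> x = 0"
  shows "\<exists>m e f \<alpha>. orthonormal_planes m e f \<and> span (e ` {..<m} \<union> f ` {..<m}) = W \<and>
     (\<forall>i<m. 0 < \<alpha> i \<and> \<alpha> i < pi) \<and>
     (\<forall>i<m. E (e i) = cos (\<alpha> i) *\<^sub>R e i - sin (\<alpha> i) *\<^sub>R f i \<and>
            E (f i) = sin (\<alpha> i) *\<^sub>R e i + cos (\<alpha> i) *\<^sub>R f i)"
  using W nr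
proof (induction "dim W" arbitrary: W rule: less_induct)
  case less
  note W = less.prems(1-3) and nr = less.prems(4)
  show ?case
  proof (cases "W = {0}")
    case True
    have "orthonormal_planes 0 (\<lambda>_. 0::'v) (\<lambda>_. 0)"
      by (simp add: orthonormal_planes_def)
    with True show ?thesis
      by (intro exI[of _ 0] exI[of _ "\<lambda>_. 0"]) simp
  next
    case False
    have "(E + G) x \<bullet> y = x \<bullet> (E + G) y" for x y
      using adj[of x y] adj[of y x] by (simp add: blinfun.bilinear_simps inner_add_left inner_add_right inner_commute)
    moreover have "(E + G) ` W \<subseteq> W"
      using W by (auto simp: blinfun.bilinear_simps intro!: subspace_add)
    ultimately obtain x d where x: "x \<in> W" "norm x = 1" and d: "(E + G) x = d *\<^sub>R x"
      using symmetric_eigenvector[of "E + G" W] W False by metis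
    \<comment> \<open>On a plane rotated by an angle \<open>a\<close> the map \<open>E + G\<close>
      is the scalar \<open>2 cos a\<close>, so \<open>c\<close> is going to be the cosine.\<close>
    define c where "c = d / 2"
    have EG: "E x + G x = c *\<^sub>R x + c *\<^sub>R x"
      using d by (simp add: blinfun.bilinear_simps c_def flip: scaleR_add_left)
    then have Gx: "G x = c *\<^sub>R x + c *\<^sub>R x - E x"
      by (metis add_diff_cancel_left')
    have EEx: "E (E x) = c *\<^sub>R E x + c *\<^sub>R E x - x"
    proof -
      have "E (E x + G x) = c *\<^sub>R E x + c *\<^sub>R E x"
        by (simp add: EG blinfun.bilinear_simps)
      then show ?thesis by (metis add_diff_cancel_right' blinfun.add_right inv(1))
    qed
    have xx: "x \<bullet> x = 1"
      using x by (simp add: dot_square_norm)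
    have iso: "E u \<bullet> E v = u \<bullet> v" for u v
      by (simp add: adj inv)
    have cx: "E x \<bullet> x = c"
    proof -
      have "E x \<bullet> x + G x \<bullet> x = 2 * c"
        by (simp add: Gx inner_diff_left inner_add_left xx)
      moreover have "G x \<bullet> x = E x \<bullet> x"
        using adj[of x x] by (simp add: inner_commute)
      ultimately show ?thesis by simp
    qed
    \<comment> \<open>Minus the component of \<open>E x\<close> orthogonal to \<open>x\<close>; the
      sign matches the block convention with a positive sine.\<close>
    define y where "y = c *\<^sub>R x - E x"
    have yy: "y \<bullet> y = 1 - c\<^sup>2"
      by (simp add: y_def inner_diff_left inner_diff_right cx iso xx inner_commute[of x "E x"] power2_eq_square)
    have "y \<noteq> 0"
    proof
      assume "y = 0"
      then have Ex: "E x = c *\<^sub>R x" and "c\<^sup>2 = 1"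
        using yy by (simp_all add: y_def)
      then have "E (E x) = x"
        by (simp add: blinfun.bilinear_simps power2_eq_square)
      with nr x have "x = 0" by blast
      with x show False by simp
    qed
    then have c1: "c\<^sup>2 < 1"
      using yy by (metis diff_gt_0_iff_gt inner_gt_zero_iff)
    then have c1': "-1 < c" "c < 1"
      by (simp_all add: power2_less_1_iff abs_less_iff abs_square_less_1)
    define a where "a = arccos c"
    have ca: "cos a = c" and a: "0 < a" "a < pi"
      using c1' arccos_lt_bounded[of c] by (simp_all add: a_def)
    define s where "s = sin a"
    have s0: "s > 0" using a by (simp add: s_def sin_gt_zero)
    have s2: "s * s = 1 - c\<^sup>2"
      using sin_cos_squared_add[of a] by (simp add: s_def ca power2_eq_square)
    define z where "z = (1 / s) *\<^sub>R y"
    have sz: "s *\<^sub>R z = c *\<^sub>R x - E x" using s0 by (simp add: z_def y_def)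
    have Ex: "E x = c *\<^sub>R x - s *\<^sub>R z" by (simp add: sz)
    have zz: "z \<bullet> z = 1"
      using s0 by (simp add: z_def yy flip: s2)
    have xz: "x \<bullet> z = 0"
      by (simp add: z_def y_def inner_diff_right xx cx inner_commute[of x "E x"])
    have zW: "z \<in> W"
      unfolding z_def y_def using W x by (intro subspace_scale subspace_diff) auto
    have Ez: "E z = s *\<^sub>R x + c *\<^sub>R z"
    proof -
      have "s *\<^sub>R E z = E (s *\<^sub>R z)" by (simp add: blinfun.bilinear_simps)
      also have "\<dots> = c *\<^sub>R E x - E (E x)" by (simp add: sz blinfun.bilinear_simps)
      also have "\<dots> = x - c *\<^sub>R E x" by (simp add: EEx)
      also have "\<dots> = (1 - c\<^sup>2) *\<^sub>R x + (c * s) *\<^sub>R z"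
        by (simp add: Ex algebra_simps power2_eq_square)
      also have "\<dots> = s *\<^sub>R (s *\<^sub>R x + c *\<^sub>R z)"
        by (simp add: scaleR_add_right s2 mult.commute)
      finally show ?thesis using s0 by simp
    qed
    have Gx': "G x = c *\<^sub>R x + s *\<^sub>R z"
      by (simp add: Gx Ex)
    have Gz: "G z = c *\<^sub>R z - s *\<^sub>R x"
    proof -
      have "s *\<^sub>R G z = G (s *\<^sub>R z)" by (simp add: blinfun.bilinear_simps)
      also have "\<dots> = c *\<^sub>R G x - x" by (simp add: sz blinfun.bilinear_simps inv)
      also have "\<dots> = (c * s) *\<^sub>R z - (1 - c\<^sup>2) *\<^sub>R x"
        by (simp add: Gx' algebra_simps power2_eq_square)
      also have "\<dots> = s *\<^sub>R (c *\<^sub>R z - s *\<^sub>R x)"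
        by (simp add: scaleR_diff_right s2 mult.commute)
      finally show ?thesis using s0 by simp
    qed
    define W' where "W' = {w \<in> W. w \<bullet> x = 0 \<and> w \<bullet> z = 0}"
    have subW': "subspace W'"
      unfolding W'_def subspace_def using W
      by (auto simp: subspace_0 subspace_add subspace_scale inner_add_left)
    have W'W: "W' \<subseteq> W" by (auto simp: W'_def)
    \<comment> \<open>The complement is invariant under each of \<open>E\<close> and
      \<open>G\<close> because the plane is invariant under the other, its adjoint.\<close>
    have EW': "E ` W' \<subseteq> W'"
      using W by (auto simp: W'_def adj Gx' Gz inner_add_right inner_diff_right)
    have GW': "G ` W' \<subseteq> W'"
    proof -
      have "G w \<bullet> v = w \<bullet> E v" for w v
        by (metis adj inner_commute)
      then show ?thesis
        using W by (auto simp: W'_def Ex Ez inner_add_right inner_diff_right)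
    qed
    have dim: "dim W' < dim W"
    proof (rule dim_psubset)
      have "x \<notin> W'" by (simp add: W'_def xx)
      then have "W' \<subset> W" using W'W x by blast
      then show "span W' \<subset> span W"
        using W subW' by (metis span_eq_iff)
    qed
    have "\<forall>x\<in>W'. E (E x) = x \<longrightarrow> x = 0"
      using nr W'W by blast
    from less.hyps[OF dim subW' EW' GW' this] obtain m e f \<alpha> where
      on: "orthonormal_planes m e f" and sp: "span (e ` {..<m} \<union> f ` {..<m}) = W'"
      and ang: "\<forall>i<m. 0 < \<alpha> i \<and> \<alpha> i < pi"
      and rot: "\<forall>i<m. E (e i) = cos (\<alpha> i) *\<^sub>R e i - sin (\<alpha> i) *\<^sub>R f i \<and>
            E (f i) = sin (\<alpha> i) *\<^sub>R e i + cos (\<alpha> i) *\<^sub>R f i"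
      by (elim exE conjE)
    have mem: "e i \<in> W'" "f i \<in> W'" if "i < m" for i
      unfolding sp[symmetric] using that by (auto intro!: span_base)
    have perp: "e i \<bullet> x = 0" "f i \<bullet> x = 0" "e i \<bullet> z = 0" "f i \<bullet> z = 0"
      "x \<bullet> e i = 0" "x \<bullet> f i = 0" "z \<bullet> e i = 0" "z \<bullet> f i = 0" if "i < m" for i
      using mem[OF that] by (auto simp: W'_def inner_commute)
    let ?e = "e(m := x)" and ?f = "f(m := z)" and ?\<alpha> = "\<alpha>(m := a)"
    have "orthonormal_planes (Suc m) ?e ?f"
      using on perp by (auto simp: orthonormal_planes_def less_Suc_eq xx zz xz)
    moreover have "span (?e ` {..<Suc m} \<union> ?f ` {..<Suc m}) = W"
    proof -
      have "?e ` {..<Suc m} \<union> ?f ` {..<Suc m} = insert x (insert z (e ` {..<m} \<union> f ` {..<m}))"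
        by (auto simp: lessThan_Suc)
      moreover have "span (insert x (insert z (e ` {..<m} \<union> f ` {..<m}))) = W" (is "span ?X = W")
      proof
        show "span ?X \<subseteq> W"
          using W x zW mem W'W by (intro span_minimal) auto
        show "W \<subseteq> span ?X"
        proof
          fix w assume "w \<in> W"
          let ?w = "w - (w \<bullet> x) *\<^sub>R x - (w \<bullet> z) *\<^sub>R z"
          have "?w \<in> W'"
            using \<open>w \<in> W\<close> x zW W
            by (auto simp: W'_def inner_diff_left xx zz xz inner_commute[of z x]
                intro!: subspace_diff subspace_scale)
          then have "?w \<in> span ?X"
            unfolding sp[symmetric] by (rule set_mp[OF span_mono, rotated]) blast
          moreover have "(w \<bullet> x) *\<^sub>R x + (w \<bullet> z) *\<^sub>R z \<in> span ?X"
            by (intro span_add span_scale) (auto intro: span_base)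
          ultimately have "?w + ((w \<bullet> x) *\<^sub>R x + (w \<bullet> z) *\<^sub>R z) \<in> span ?X"
            by (rule span_add)
          then show "w \<in> span ?X" by simp
        qed
      qed
      ultimately show ?thesis by simp
    qed
    moreover have "\<forall>i<Suc m. 0 < ?\<alpha> i \<and> ?\<alpha> i < pi"
      using ang a by (simp add: less_Suc_eq)
    moreover have "\<forall>i<Suc m. E (?e i) = cos (?\<alpha> i) *\<^sub>R ?e i - sin (?\<alpha> i) *\<^sub>R ?f i \<and>
            E (?f i) = sin (?\<alpha> i) *\<^sub>R ?e i + cos (?\<alpha> i) *\<^sub>R ?f i"
      using rot Ex Ez by (simp add: less_Suc_eq ca s_def)
    ultimately show ?thesis by blast
  qed
qed


section \<open>Rotation blocks and their square roots\<close>

lemma planes_sum_inner: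
  assumes "orthonormal_planes m e f" "j < m"
  shows "(\<Sum>i<m. a i *\<^sub>R e i + b i *\<^sub>R f i) \<bullet> e j = a j"
    and "(\<Sum>i<m. a i *\<^sub>R e i + b i *\<^sub>R f i) \<bullet> f j = b j"
proof -
  have "(\<Sum>i<m. a i *\<^sub>R e i + b i *\<^sub>R f i) \<bullet> e j = (\<Sum>i<m. if i = j then a i else 0)"
    unfolding inner_sum_left using assms
    by (intro sum.cong refl) (simp add: inner_add_left orthonormal_planesD)
  then show "(\<Sum>i<m. a i *\<^sub>R e i + b i *\<^sub>R f i) \<bullet> e j = a j"
    using assms by simp
  have "(\<Sum>i<m. a i *\<^sub>R e i + b i *\<^sub>R f i) \<bullet> f j = (\<Sum>i<m. if i = j then b i else 0)"
    unfolding inner_sum_left using assms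
    by (intro sum.cong refl) (simp add: inner_add_left orthonormal_planesD)
  then show "(\<Sum>i<m. a i *\<^sub>R e i + b i *\<^sub>R f i) \<bullet> f j = b j"
    using assms by simp
qed

lemma planes_decomposition:
  assumes "orthonormal_planes m e f"
  obtains a b z where "x = (\<Sum>i<m. a i *\<^sub>R e i + b i *\<^sub>R f i) + z"
    "\<forall>i<m. z \<bullet> e i = 0 \<and> z \<bullet> f i = 0"
proof
  let ?s = "\<Sum>i<m. (x \<bullet> e i) *\<^sub>R e i + (x \<bullet> f i) *\<^sub>R f i"
  show "x = ?s + (x - ?s)" by simp
  show "\<forall>i<m. (x - ?s) \<bullet> e i = 0 \<and> (x - ?s) \<bullet> f i = 0"
    using planes_sum_inner[OF assms, where a = "\<lambda>i. x \<bullet> e i" and b = "\<lambda>i. x \<bullet> f i"]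
    by (simp add: inner_diff_left)
qed

lemma planes_endo_eqI:
  fixes T U :: "'v::euclidean_space endo"
  assumes "orthonormal_planes m e f"
    and "\<And>i. i < m \<Longrightarrow> T (e i) = U (e i)" "\<And>i. i < m \<Longrightarrow> T (f i) = U (f i)"
    and "\<And>z. \<forall>i<m. z \<bullet> e i = 0 \<and> z \<bullet> f i = 0 \<Longrightarrow> T z = U z"
  shows "T = U"
proof (rule blinfun_eqI)
  fix x
  from planes_decomposition[OF assms(1), of x] obtain a b z
    where x: "x = (\<Sum>i<m. a i *\<^sub>R e i + b i *\<^sub>R f i) + z"
      and z: "\<forall>i<m. z \<bullet> e i = 0 \<and> z \<bullet> f i = 0" .
  show "T x = U x"
    unfolding x using assms(2,3) assms(4)[OF z]
    by (simp add: blinfun.bilinear_simps blinfun.sum_right)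
qed

lemma planes_inner:
  assumes "orthonormal_planes m e f"
    and z: "\<forall>i<m. z \<bullet> e i = 0 \<and> z \<bullet> f i = 0" and z': "\<forall>i<m. z' \<bullet> e i = 0 \<and> z' \<bullet> f i = 0"
  shows "((\<Sum>i<m. a i *\<^sub>R e i + b i *\<^sub>R f i) + z) \<bullet> ((\<Sum>i<m. a' i *\<^sub>R e i + b' i *\<^sub>R f i) + z')
     = (\<Sum>i<m. a i * a' i + b i * b' i) + z \<bullet> z'"
proof -
  let ?s = "\<Sum>i<m. a i *\<^sub>R e i + b i *\<^sub>R f i" and ?s' = "\<Sum>i<m. a' i *\<^sub>R e i + b' i *\<^sub>R f i"
  have "?s \<bullet> ?s' = (\<Sum>i<m. a i * a' i + b i * b' i)"
    unfolding inner_sum_right[of ?s]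
    using planes_sum_inner[OF assms(1), of _ a b]
    by (intro sum.cong refl) (simp add: inner_add_right mult.commute)
  moreover have "z \<bullet> ?s' = 0" "z' \<bullet> ?s = 0"
    using z z' by (simp_all add: inner_sum_right inner_add_right)
  ultimately show ?thesis
    by (simp add: inner_add_left inner_add_right inner_commute[of ?s z'])
qed

lemma rotation_blocks_exists:
  fixes e f :: "nat \<Rightarrow> 'v::euclidean_space"
  assumes on: "orthonormal_planes m e f"
  obtains R where "rotation_blocks m e f \<alpha> R"
proof
  \<comment> \<open>\<open>L\<close> adds to the identity, on each plane, the difference between the
    rotation and the identity, weighted by the coordinates of \<open>x\<close>.\<close>
  define L where "L x = x + (\<Sum>i<m. (x \<bullet> e i) *\<^sub>R (cos (\<alpha> i) *\<^sub>R e i - sin (\<alpha> i) *\<^sub>R f i - e i)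
    + (x \<bullet> f i) *\<^sub>R (sin (\<alpha> i) *\<^sub>R e i + cos (\<alpha> i) *\<^sub>R f i - f i))" for x
  have "linear L"
  proof
    show "L (x + y) = L x + L y" for x y
      by (simp add: L_def inner_add_left scaleR_add_left sum.distrib)
    show "L (r *\<^sub>R x) = r *\<^sub>R L x" for r x
      unfolding L_def scaleR_add_right scaleR_sum_right inner_scaleR_left scaleR_scaleR ..
  qed
  then have L: "blinfun_apply (Blinfun L) = L"
    by (simp add: bounded_linear_Blinfun_apply linear_conv_bounded_linear)
  have "L (e j) = cos (\<alpha> j) *\<^sub>R e j - sin (\<alpha> j) *\<^sub>R f j \<and>
        L (f j) = sin (\<alpha> j) *\<^sub>R e j + cos (\<alpha> j) *\<^sub>R f j" if j: "j < m" for j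
  proof
    have "L (e j) = e j + (\<Sum>i<m. if i = j then cos (\<alpha> i) *\<^sub>R e i - sin (\<alpha> i) *\<^sub>R f i - e i else 0)"
      unfolding L_def using j
      by (intro arg_cong2[where f = "(+)"] sum.cong refl) (auto simp: orthonormal_planesD[OF on])
    then show "L (e j) = cos (\<alpha> j) *\<^sub>R e j - sin (\<alpha> j) *\<^sub>R f j"
      using j by simp
    have "L (f j) = f j + (\<Sum>i<m. if i = j then sin (\<alpha> i) *\<^sub>R e i + cos (\<alpha> i) *\<^sub>R f i - f i else 0)"
      unfolding L_def using j
      by (intro arg_cong2[where f = "(+)"] sum.cong refl) (auto simp: orthonormal_planesD[OF on])
    then show "L (f j) = sin (\<alpha> j) *\<^sub>R e j + cos (\<alpha> j) *\<^sub>R f j"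
      using j by simp
  qed
  then show "rotation_blocks m e f \<alpha> (Blinfun L)"
    by (auto simp: rotation_blocks_def L) (simp add: L_def)
qed

lemma rotation_blocks_unique:
  assumes "orthonormal_planes m e f" "rotation_blocks m e f \<alpha> R" "rotation_blocks m e f \<alpha> R'"
  shows "R = R'"
  using assms by (intro planes_endo_eqI[OF assms(1)]) (auto simp: rotation_blocks_def)

lemma rotation_blocks_compose:
  assumes "rotation_blocks m e f \<alpha> R" "rotation_blocks m e f \<beta> R'"
  shows "rotation_blocks m e f (\<lambda>i. \<alpha> i + \<beta> i) (R o\<^sub>L R')"
  using assms unfolding rotation_blocks_def
  by (auto simp: blinfun.bilinear_simps cos_add sin_add scaleR_add_left scaleR_diff_left
      scaleR_add_right scaleR_diff_right mult.commute)

lemma rotation_blocks_apply: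
  assumes "rotation_blocks m e f \<alpha> R" "\<forall>i<m. z \<bullet> e i = 0 \<and> z \<bullet> f i = 0"
  shows "R ((\<Sum>i<m. a i *\<^sub>R e i + b i *\<^sub>R f i) + z) =
    (\<Sum>i<m. (a i * cos (\<alpha> i) + b i * sin (\<alpha> i)) *\<^sub>R e i +
             (b i * cos (\<alpha> i) - a i * sin (\<alpha> i)) *\<^sub>R f i) + z"
proof -
  have "R (a i *\<^sub>R e i + b i *\<^sub>R f i) = (a i * cos (\<alpha> i) + b i * sin (\<alpha> i)) *\<^sub>R e i +
             (b i * cos (\<alpha> i) - a i * sin (\<alpha> i)) *\<^sub>R f i" if "i < m" for i
    using assms(1) that unfolding rotation_blocks_def
    by (simp add: blinfun.bilinear_simps scaleR_add_left scaleR_diff_left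
      scaleR_add_right scaleR_diff_right)
  moreover have "R z = z"
    using assms by (simp add: rotation_blocks_def)
  ultimately show ?thesis
    by (simp add: blinfun.sum_right blinfun.add_right[of R "sum _ _"])
qed

lemma rotation_blocks_orthogonal:
  assumes on: "orthonormal_planes m e f" and R: "rotation_blocks m e f \<alpha> R"
  shows "orthogonal_endo R"
proof -
  have "R x \<bullet> R x = x \<bullet> x" for x
  proof -
    from planes_decomposition[OF on, of x] obtain a b z
      where x: "x = (\<Sum>i<m. a i *\<^sub>R e i + b i *\<^sub>R f i) + z"
        and z: "\<forall>i<m. z \<bullet> e i = 0 \<and> z \<bullet> f i = 0" .
    have "(p * c + q * s) * (p * c + q * s) + (q * c - p * s) * (q * c - p * s)
        = (p * p + q * q) * (s\<^sup>2 + c\<^sup>2)" for p q c s :: real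
      by (simp add: power2_eq_square algebra_simps)
    then show ?thesis
      unfolding x rotation_blocks_apply[OF R z] planes_inner[OF on z z] by simp
  qed
  then show ?thesis
    by (simp add: orthogonal_endo_iff_norm norm_eq_sqrt_inner)
qed

text \<open>In the quadratic form of a plane rotation the sine terms cancel, leaving the cosine
  times the squared length.\<close>

lemma rotation_blocks_nonneg:
  assumes on: "orthonormal_planes m e f" and R: "rotation_blocks m e f \<alpha> R"
    and cos: "\<forall>i<m. 0 \<le> cos (\<alpha> i)"
  shows "0 \<le> R x \<bullet> x"
proof -
  from planes_decomposition[OF on, of x] obtain a b z
    where x: "x = (\<Sum>i<m. a i *\<^sub>R e i + b i *\<^sub>R f i) + z"
      and z: "\<forall>i<m. z \<bullet> e i = 0 \<and> z \<bullet> f i = 0" .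
  have "0 \<le> (a i * cos (\<alpha> i) + b i * sin (\<alpha> i)) * a i + (b i * cos (\<alpha> i) - a i * sin (\<alpha> i)) * b i"
    if "i < m" for i
  proof -
    have "0 \<le> cos (\<alpha> i) * (a i * a i + b i * b i)"
      using cos that by simp
    then show ?thesis by (simp add: algebra_simps)
  qed
  then show ?thesis
    unfolding x rotation_blocks_apply[OF R z] planes_inner[OF on z z]
    by (intro add_nonneg_nonneg[OF sum_nonneg]) auto
qed

section \<open>The half-angle square root and its uniqueness\<close>

lemma cos_half_pos: "- pi < a \<Longrightarrow> a < pi \<Longrightarrow> 0 < cos (a / 2)"
  by (rule cos_gt_zero_pi) auto

text \<open>These properties no longer mention the planes, and they are what
  \<open>square_root_on_plane\<close> asks of a root.\<close>

lemma rotation_blocks_half: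
  assumes on: "orthonormal_planes m e f"
    and a: "\<forall>i<m. - pi < \<alpha> i \<and> \<alpha> i < pi"
    and D: "rotation_blocks m e f \<alpha> D" and R: "rotation_blocks m e f (\<lambda>i. \<alpha> i / 2) R"
  shows "orthogonal_endo R" "0 \<le> R x \<bullet> x" "R (R x) = D x"
proof -
  show "orthogonal_endo R"
    by (rule rotation_blocks_orthogonal[OF on R])
  show "0 \<le> R x \<bullet> x"
    using a cos_half_pos by (intro rotation_blocks_nonneg[OF on R]) (auto intro: less_imp_le)
  have "rotation_blocks m e f \<alpha> (R o\<^sub>L R)"
    using rotation_blocks_compose[OF R R] by simp
  from rotation_blocks_unique[OF on this D] show "R (R x) = D x"
    by (metis blinfun_apply_blinfun_compose)
qed

text \<open>The hypothesis on \<open>v\<close> says \<open>D v + D\<^sup>-\<^sup>1 v = 2 cos \<alpha> v\<close>. With \<open>c = cos (\<alpha> / 2)\<close> it factors as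
  \<open>(R\<^sup>2 + 2 c R + 1) (R\<^sup>2 - 2 c R + 1) v = 0\<close>, and the first factor is injective because
  \<open>R + R\<^sup>T\<close> is nonnegative. As the hypothesis does not mention \<open>R\<close>, this determines \<open>R\<close>.\<close>

lemma square_root_on_plane:
  fixes D R :: "'v::euclidean_space endo"
  assumes R: "orthogonal_endo R" "\<And>x. 0 \<le> R x \<bullet> x" "\<And>x. R (R x) = D x"
    and a: "- pi < a" "a < pi"
    and v: "D (D v) - (2 * cos a) *\<^sub>R D v + v = 0"
  shows "R v = (1 / (2 * cos (a / 2))) *\<^sub>R (D v + v)"
proof -
  define c where "c = cos (a / 2)"
  have c: "c > 0" unfolding c_def by (rule cos_half_pos[OF a])
  have ca: "cos a = 2 * c\<^sup>2 - 1"
    using cos_double_cos[of "a / 2"] by (simp add: c_def)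
  \<comment> \<open>The factor \<open>R^2 - 2 c R + 1\<close> applied to \<open>v\<close>, with
    \<open>R (R v)\<close> written as \<open>D v\<close>.\<close>
  define w where "w = D v + v - (2 * c) *\<^sub>R R v"
  have DR: "R (D x) = D (R x)" for x
    by (simp flip: R(3))
  have "D w + w + (2 * c) *\<^sub>R R w = D (D v) - (2 * cos a) *\<^sub>R D v + v"
  proof -
    have "D v + D v = 2 *\<^sub>R D v" by (simp add: scaleR_2)
    then show ?thesis
      by (simp add: w_def blinfun.bilinear_simps DR R(3) ca power2_eq_square algebra_simps)
  qed
  \<comment> \<open>The other factor, applied to \<open>w\<close>, is paired with
    \<open>R w\<close>: two terms are nonnegative by assumption, the third is \<open>2 c\<close>
    times the squared length of \<open>R w\<close>.\<close>
  then have "0 = (D w + w + (2 * c) *\<^sub>R R w) \<bullet> R w"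
    by (simp add: v)
  also have "\<dots> = R (R w) \<bullet> R w + R w \<bullet> w + 2 * c * (R w \<bullet> R w)"
    by (simp add: inner_add_left inner_commute[of w] R(3))
  finally have "2 * c * (R w \<bullet> R w) \<le> 0"
    using R(2)[of "R w"] R(2)[of w] by linarith
  moreover have "R w \<bullet> R w = w \<bullet> w"
    using R(1) by (simp add: orthogonal_endo_iff_inner)
  ultimately have "w = 0"
    using c by (smt (verit) inner_gt_zero_iff mult_pos_pos)
  then have "(2 * c) *\<^sub>R R v = D v + v"
    by (simp add: w_def)
  moreover have "R v = (1 / (2 * c)) *\<^sub>R ((2 * c) *\<^sub>R R v)"
    using c by simp
  ultimately show ?thesis
    by (simp add: c_def)
qed

text \<open>The Cayley-Hamilton identity of each plane rotation. Fixed vectors are given the angle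
  \<open>0\<close>, so that \<open>square_root_on_plane\<close> covers the planes and their
  complement alike.\<close>

lemma rotation_blocks_quadratic:
  fixes D :: "'a::euclidean_space endo"
  assumes "rotation_blocks m e f \<alpha> D"
  shows "i < m \<Longrightarrow> D (D (e i)) - (2 * cos (\<alpha> i)) *\<^sub>R D (e i) + e i = 0"
    and "i < m \<Longrightarrow> D (D (f i)) - (2 * cos (\<alpha> i)) *\<^sub>R D (f i) + f i = 0"
    and "\<forall>i<m. z \<bullet> e i = 0 \<and> z \<bullet> f i = 0 \<Longrightarrow> D (D z) - (2 * cos 0) *\<^sub>R D z + z = 0"
proof -
  have unit: "1 - cos a * cos a - sin a * sin a = 0" for a :: real
    using sin_cos_squared_add[of a] by (simp add: power2_eq_square)
  assume "i < m"
  define c s where "c = cos (\<alpha> i)" and "s = sin (\<alpha> i)"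
  have two: "(2 * r) *\<^sub>R u = r *\<^sub>R u + r *\<^sub>R u" for r and u :: 'a
    by (simp flip: scaleR_add_left)
  have De: "D (e i) = c *\<^sub>R e i - s *\<^sub>R f i" and Df: "D (f i) = s *\<^sub>R e i + c *\<^sub>R f i"
    using assms \<open>i < m\<close> by (simp_all add: rotation_blocks_def c_def s_def)
  have "D (D (e i)) - (2 * c) *\<^sub>R D (e i) + e i = (1 - c * c - s * s) *\<^sub>R e i"
    unfolding De Df blinfun.diff_right blinfun.scaleR_right two by (simp add: algebra_simps)
  then show "D (D (e i)) - (2 * cos (\<alpha> i)) *\<^sub>R D (e i) + e i = 0"
    unfolding c_def s_def unit by simp
  have "D (D (f i)) - (2 * c) *\<^sub>R D (f i) + f i = (1 - c * c - s * s) *\<^sub>R f i"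
    unfolding De Df blinfun.add_right blinfun.scaleR_right two by (simp add: algebra_simps)
  then show "D (D (f i)) - (2 * cos (\<alpha> i)) *\<^sub>R D (f i) + f i = 0"
    unfolding c_def s_def unit by simp
next
  show "D (D z) - (2 * cos 0) *\<^sub>R D z + z = 0" if "\<forall>i<m. z \<bullet> e i = 0 \<and> z \<bullet> f i = 0"
    using assms that by (simp add: rotation_blocks_def scaleR_2)
qed

text \<open>Two roots may come from different planes and angles, but
  \<open>square_root_on_plane\<close> determines both from \<open>D\<close> alone, so it suffices to
  compare them along one decomposition.\<close>

lemma rotation_sqrt_eq:
  assumes on: "orthonormal_planes m e f"
    and a: "\<forall>i<m. - pi < \<alpha> i \<and> \<alpha> i < pi"
    and D: "rotation_blocks m e f \<alpha> D" and R: "rotation_blocks m e f (\<lambda>i. \<alpha> i / 2) R"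
  shows "rotation_sqrt D = R"
  unfolding rotation_sqrt_def
proof (rule the_equality)
  fix R' assume "\<exists>m e f \<alpha>. orthonormal_planes m e f \<and> (\<forall>i<m. - pi < \<alpha> i \<and> \<alpha> i < pi) \<and>
    rotation_blocks m e f \<alpha> D \<and> rotation_blocks m e f (\<lambda>i. \<alpha> i / 2) R'"
  then obtain m' e' f' \<alpha>' where on': "orthonormal_planes m' e' f'"
    and a': "\<forall>i<m'. - pi < \<alpha>' i \<and> \<alpha>' i < pi"
    and D': "rotation_blocks m' e' f' \<alpha>' D"
    and R': "rotation_blocks m' e' f' (\<lambda>i. \<alpha>' i / 2) R'"
    by (elim exE conjE)
  note half = rotation_blocks_half[OF on a D R] and half' = rotation_blocks_half[OF on' a' D' R']
  have eq: "R' v = R v" if "- pi < c" "c < pi" "D (D v) - (2 * cos c) *\<^sub>R D v + v = 0" for c v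
    using square_root_on_plane[OF half that] square_root_on_plane[OF half' that] by simp
  show "R' = R"
  proof (rule planes_endo_eqI[OF on])
    show "R' (e i) = R (e i)" "R' (f i) = R (f i)" if "i < m" for i
      using rotation_blocks_quadratic(1,2)[OF D that] a that eq[of "\<alpha> i"] by blast+
    show "R' z = R z" if "\<forall>i<m. z \<bullet> e i = 0 \<and> z \<bullet> f i = 0" for z
      using rotation_blocks_quadratic(3)[OF D that] by (intro eq[of 0]) simp_all
  qed
qed (use assms in blast)

text \<open>\<open>Q\<close> maps solutions of the quadratic relation to solutions with the same
  angle, and on these \<open>R\<close> is one and the same polynomial in \<open>D\<close>.\<close>

lemma square_root_commutes:
  fixes D R Q :: "'v::euclidean_space endo"
  assumes on: "orthonormal_planes m e f"
    and a: "\<forall>i<m. - pi < \<alpha> i \<and> \<alpha> i < pi"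
    and D: "rotation_blocks m e f \<alpha> D" and R: "rotation_blocks m e f (\<lambda>i. \<alpha> i / 2) R"
    and Q: "\<And>x. Q (D x) = D (Q x)"
  shows "Q o\<^sub>L R = R o\<^sub>L Q"
proof -
  note half = rotation_blocks_half[OF on a D R]
  have eq: "(Q o\<^sub>L R) v = (R o\<^sub>L Q) v"
    if c: "- pi < c" "c < pi" and v: "D (D v) - (2 * cos c) *\<^sub>R D v + v = 0" for c v
  proof -
    have "D (D (Q v)) - (2 * cos c) *\<^sub>R D (Q v) + Q v = Q (D (D v) - (2 * cos c) *\<^sub>R D v + v)"
      by (simp add: blinfun.bilinear_simps Q)
    also have "\<dots> = 0" by (simp add: v blinfun.bilinear_simps)
    finally show ?thesis
      by (simp add: square_root_on_plane[OF half c] v blinfun.bilinear_simps Q)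
  qed
  show ?thesis
  proof (rule planes_endo_eqI[OF on])
    show "(Q o\<^sub>L R) (e i) = (R o\<^sub>L Q) (e i)" "(Q o\<^sub>L R) (f i) = (R o\<^sub>L Q) (f i)" if "i < m" for i
      using rotation_blocks_quadratic(1,2)[OF D that] a that eq[of "\<alpha> i"] by blast+
    show "(Q o\<^sub>L R) z = (R o\<^sub>L Q) z" if "\<forall>i<m. z \<bullet> e i = 0 \<and> z \<bullet> f i = 0" for z
      using rotation_blocks_quadratic(3)[OF D that] by (intro eq[of 0]) simp_all
  qed
qed

text \<open>The hypothesis on \<open>B\<close> says that moving \<open>D\<close> across
  \<open>B\<close> inverts it. The quadratic relation is invariant under inverting \<open>D\<close>,
  so \<open>B\<close> preserves the solutions for a given angle, where \<open>R\<close> is a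
  multiple of \<open>D + 1\<close>.\<close>

lemma square_root_inverts:
  fixes D R B :: "'v::euclidean_space endo"
  assumes on: "orthonormal_planes m e f"
    and a: "\<forall>i<m. - pi < \<alpha> i \<and> \<alpha> i < pi"
    and D: "rotation_blocks m e f \<alpha> D" and R: "rotation_blocks m e f (\<lambda>i. \<alpha> i / 2) R"
    and B: "\<And>x. D (B (D x)) = B x"
  shows "R o\<^sub>L B o\<^sub>L R = B"
proof -
  note half = rotation_blocks_half[OF on a D R]
  have eq: "(R o\<^sub>L B o\<^sub>L R) v = B v"
    if c: "- pi < c" "c < pi" and v: "D (D v) - (2 * cos c) *\<^sub>R D v + v = 0" for c v
  proof -
    define k where "k = cos (c / 2)"
    have k: "k > 0" unfolding k_def by (rule cos_half_pos[OF c])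
    have ck: "cos c = 2 * k\<^sup>2 - 1"
      using cos_double_cos[of "c / 2"] by (simp add: k_def)
    \<comment> \<open>Applying \<open>D D B\<close> to the relation for \<open>v\<close> returns the
      relation for \<open>B v\<close>, with its outer terms exchanged.\<close>
    have "D (D (B v)) - (2 * cos c) *\<^sub>R D (B v) + B v
        = D (D (B (D (D v) - (2 * cos c) *\<^sub>R D v + v)))"
      by (simp add: blinfun.bilinear_simps B)
    also have "\<dots> = 0" by (simp add: v blinfun.bilinear_simps)
    finally have "D (D (B v)) - (2 * cos c) *\<^sub>R D (B v) + B v = 0" .
    note RB = square_root_on_plane[OF half c this]
    \<comment> \<open>This expresses \<open>B (D v)\<close>, the inverse of \<open>D\<close> applied
      to \<open>B v\<close>, through \<open>D\<close> itself.\<close>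
    have "0 = D (B (D (D v) - (2 * cos c) *\<^sub>R D v + v))"
      by (simp only: v blinfun.zero_right)
    also have "\<dots> = B (D v) - (2 * cos c) *\<^sub>R B v + D (B v)"
      by (simp add: blinfun.bilinear_simps B)
    finally have BD: "B (D v) = (2 * cos c) *\<^sub>R B v - D (B v)"
      by (simp add: algebra_simps)
    have RRB: "R (D x) = D (R x)" for x
      by (simp flip: half(3))
    have "R (B (D v + v)) = (2 * cos c + 1) *\<^sub>R R (B v) - D (R (B v))"
      by (simp add: BD blinfun.bilinear_simps RRB algebra_simps)
    also have "\<dots> = (1 / (2 * k)) *\<^sub>R ((2 * cos c + 1) *\<^sub>R (D (B v) + B v) - (D (D (B v)) + D (B v)))"
      by (simp add: RB blinfun.bilinear_simps scaleR_diff_right mult.commute flip: k_def)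
    \<comment> \<open>Splitting off the relation for \<open>B v\<close> leaves the scalar
      \<open>2 cos c + 2\<close>, which is \<open>4 k^2\<close> by the double angle formula.\<close>
    also have "(2 * cos c + 1) *\<^sub>R (D (B v) + B v) - (D (D (B v)) + D (B v)) =
        (2 * cos c + 2) *\<^sub>R B v - (D (D (B v)) - (2 * cos c) *\<^sub>R D (B v) + B v)"
      by (simp add: algebra_simps scaleR_2)
    also have "\<dots> = (4 * k\<^sup>2) *\<^sub>R B v"
      using \<open>D (D (B v)) - (2 * cos c) *\<^sub>R D (B v) + B v = 0\<close> by (simp add: ck)
    finally have "R (B (D v + v)) = (2 * k) *\<^sub>R B v"
      using k by (simp add: power2_eq_square)
    then show ?thesis
      using k by (simp add: square_root_on_plane[OF half c v] blinfun.scaleR_right flip: k_def)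
  qed
  show ?thesis
  proof (rule planes_endo_eqI[OF on])
    show "(R o\<^sub>L B o\<^sub>L R) (e i) = B (e i)" "(R o\<^sub>L B o\<^sub>L R) (f i) = B (f i)" if "i < m" for i
      using rotation_blocks_quadratic(1,2)[OF D that] a that eq[of "\<alpha> i"] by blast+
    show "(R o\<^sub>L B o\<^sub>L R) z = B z" if "\<forall>i<m. z \<bullet> e i = 0 \<and> z \<bullet> f i = 0" for z
      using rotation_blocks_quadratic(3)[OF D that] by (intro eq[of 0]) simp_all
  qed
qed


section \<open>Conjugating \<open>B\<close> to an involutive deformation of \<open>A\<close>\<close>

lemma kernel_decomposition:
  fixes K :: "'v::euclidean_space set"
  assumes "subspace K"
  obtains p z where "x = p + z" "p \<in> orthogonal_comp K" "z \<in> K"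
proof -
  obtain z p where "z \<in> span K" "\<And>w. w \<in> span K \<Longrightarrow> orthogonal p w" "x = z + p"
    using orthogonal_subspace_decomp_exists[of K x] by blast
  then show thesis
    using that[of p z] assms
    by (auto simp: orthogonal_comp_def orthogonal_commute span_eq_iff[THEN iffD2] add.commute)
qed

text \<open>The last conclusion serves the continuous families: if \<open>-1\<close> is an
  eigenvalue of \<open>S\<close>, then \<open>A\<close> and \<open>B\<close> cannot be close to each
  other.\<close>

lemma rotation_part_conjugates:
  fixes A B :: "'v::euclidean_space endo" and F :: "'v endo set"
  assumes A: "unit_anticommutator F A" and B: "unit_anticommutator F B"
    and F: "\<forall>T\<in>F. skew_endo T"
  obtains S R where "rotation_sqrt (rotation_part A B) = R" "orthogonal_endo R"
    "\<And>T. T \<in> F \<Longrightarrow> R o\<^sub>L T = T o\<^sub>L R" "conj_endo R B = S o\<^sub>L A"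
    "admissible_involution F A S" "\<And>x. S x = - x \<Longrightarrow> A (B x) = x"
proof -
  note AD = unit_anticommutatorD[OF A] and BD = unit_anticommutatorD[OF B]
  define E where "E = - (A o\<^sub>L B)"
  define G where "G = - (B o\<^sub>L A)"
  have E: "E x = - A (B x)" and G: "G x = - B (A x)" for x
    by (simp_all add: E_def G_def blinfun.bilinear_simps)
  have adj: "E x \<bullet> y = x \<bullet> G y" for x y
    by (simp add: E G AD BD)
  have EG: "E (G x) = x" and GE: "G (E x) = x" for x
    by (simp_all add: E G AD BD blinfun.bilinear_simps)
  define K where "K = {x. A (B x) - B (A x) = 0}"
  define W where "W = orthogonal_comp K"
  have K: "x \<in> K \<longleftrightarrow> A (B x) = B (A x)" for x
    by (simp add: K_def)
  \<comment> \<open>As \<open>G\<close> is both adjoint and inverse of \<open>E\<close>, this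
    describes \<open>K\<close> as the set where \<open>E\<close> agrees with its adjoint, and
    equally where \<open>E\<close> squares to the identity. Hence \<open>W\<close> satisfies the
    hypothesis of the plane decomposition.\<close>
  have KEG: "x \<in> K \<longleftrightarrow> E x = G x" for x
    by (simp add: K E G)
  have sK: "subspace K"
    by (auto simp: subspace_def K blinfun.bilinear_simps)
  have sW: "subspace W"
    unfolding W_def by (rule subspace_orthogonal_comp)
  have KW: "z \<bullet> p = 0" "p \<bullet> z = 0" if "z \<in> K" "p \<in> W" for z p
    using that by (auto simp: W_def orthogonal_comp_def orthogonal_def inner_commute)
  have W0: "p = 0" if "p \<in> K" "p \<in> W" for p
    using KW[OF that] by simp
  have AK: "A x \<in> K" and BK: "B x \<in> K" if "x \<in> K" for x
    using that AD(2)[of "B x"] BD(2)[of "A x"] by (simp_all add: K AD BD blinfun.bilinear_simps)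
  have TK: "T x \<in> K" if "x \<in> K" "T \<in> F" for x T
    using that by (simp add: K AD BD blinfun.bilinear_simps)
  have skewW: "T p \<in> W" if "p \<in> W" "\<And>x. x \<in> K \<Longrightarrow> T x \<in> K" "\<And>x y. T x \<bullet> y = - (x \<bullet> T y)"
    for T :: "'v endo" and p
  proof -
    have "z \<bullet> T p = 0" if "z \<in> K" for z
      using that \<open>\<And>x. x \<in> K \<Longrightarrow> T x \<in> K\<close> \<open>\<And>x y. T x \<bullet> y = - (x \<bullet> T y)\<close>[of z p] KW(1) \<open>p \<in> W\<close> by simp
    then show ?thesis
      by (simp add: W_def orthogonal_comp_def orthogonal_def)
  qed
  have AW: "A p \<in> W" and BW: "B p \<in> W" if "p \<in> W" for p
    using skewW[of p A] skewW[of p B] that AK BK AD BD by blast+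
  have TW: "T p \<in> W" if "p \<in> W" "T \<in> F" for p T
    using skewW[of p T] that TK F by (auto simp: skew_endo_def)
  have EW: "E p \<in> W" and GW: "G p \<in> W" if "p \<in> W" for p
    using that AW BW sW by (auto simp: E G subspace_neg)
  have EK: "E z \<in> K" if "z \<in> K" for z
    using that AK BK sK by (auto simp: E subspace_neg)
  have "\<forall>x\<in>W. E (E x) = x \<longrightarrow> x = 0"
    using KEG GE W0 by metis
  moreover have "E ` W \<subseteq> W" "G ` W \<subseteq> W"
    using EW GW by auto
  ultimately obtain m e f \<alpha> where on: "orthonormal_planes m e f"
    and sp: "span (e ` {..<m} \<union> f ` {..<m}) = W"
    and a0: "\<forall>i<m. 0 < \<alpha> i \<and> \<alpha> i < pi"
    and rot: "\<forall>i<m. E (e i) = cos (\<alpha> i) *\<^sub>R e i - sin (\<alpha> i) *\<^sub>R f i \<and>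
            E (f i) = sin (\<alpha> i) *\<^sub>R e i + cos (\<alpha> i) *\<^sub>R f i"
    using invariant_plane_decomposition[OF adj EG GE sW] by metis
  have a: "\<forall>i<m. - pi < \<alpha> i \<and> \<alpha> i < pi"
    using a0 pi_gt_zero by (meson less_trans neg_less_0_iff_less)
  have perp: "z \<in> K" if z0: "\<forall>i<n. z \<bullet> e' i = 0 \<and> z \<bullet> f' i = 0"
      and sp': "span (e' ` {..<n} \<union> f' ` {..<n}) = W"
    for n :: nat and e' f' and z :: 'v
  proof -
    have "orthogonal z w" if "w \<in> W" for w
      using that z0 unfolding sp'[symmetric]
      by (intro orthogonal_to_span[of w]) (auto simp: orthogonal_def)
    then have "z \<in> orthogonal_comp W"
      by (auto simp: orthogonal_comp_def orthogonal_commute)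
    then show ?thesis
      unfolding W_def orthogonal_comp_self[OF sK] .
  qed
  have perpI: "\<forall>i<m. z \<bullet> e i = 0 \<and> z \<bullet> f i = 0" if "z \<in> K" for z
    using KW(1)[OF that] sp by (auto intro: span_base)
  obtain D where D: "rotation_blocks m e f \<alpha> D"
    using rotation_blocks_exists[OF on] .
  \<comment> \<open>Opposite angles give the inverse of \<open>D\<close>, from which the symmetric
    factor is formed as \<open>S = E D'\<close>.\<close>
  obtain D' where D': "rotation_blocks m e f (\<lambda>i. - \<alpha> i) D'"
    using rotation_blocks_exists[OF on] .
  have D'D: "D' (D x) = x" for x
  proof -
    have "rotation_blocks m e f (\<lambda>i. 0) (D' o\<^sub>L D)"
      using rotation_blocks_compose[OF D' D] by simp
    moreover have "rotation_blocks m e f (\<lambda>i. 0) id_blinfun"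
      by (simp add: rotation_blocks_def)
    ultimately have "D' o\<^sub>L D = id_blinfun"
      by (rule rotation_blocks_unique[OF on])
    then show ?thesis
      by (metis blinfun_apply_blinfun_compose id_blinfun.rep_eq id_apply)
  qed
  have DW: "D p = E p" if "p \<in> W" for p
  proof (rule linear_eq_on_span[OF linear_endo linear_endo])
    show "p \<in> span (e ` {..<m} \<union> f ` {..<m})"
      using that sp by simp
    show "D x = E x" if "x \<in> e ` {..<m} \<union> f ` {..<m}" for x
      using that D rot by (auto simp: rotation_blocks_def)
  qed
  have DK: "D z = z" "D' z = z" if "z \<in> K" for z
    using perpI[OF that] D D' by (simp_all add: rotation_blocks_def)
  define S where "S = E o\<^sub>L D'"
  have SK: "S z = E z" if "z \<in> K" for z
    by (simp add: S_def DK that)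
  have SW: "S p = p" if "p \<in> W" for p
  proof -
    have "D' (E (G p)) = G p"
      using D'D[of "G p"] by (simp add: DW GW that)
    then show ?thesis
      by (simp add: S_def EG)
  qed
  have SD: "S (D x) = E x" for x
    by (simp add: S_def D'D)
  have decomp: thesis if "\<And>p z. x = p + z \<Longrightarrow> p \<in> W \<Longrightarrow> z \<in> K \<Longrightarrow> thesis" for x thesis
    using kernel_decomposition[OF sK, of x] that unfolding W_def by blast

  have "rotation_part A B = D"
    unfolding rotation_part_def
  proof (rule the_equality, goal_cases)
    \<comment> \<open>\<open>S\<close> is the identity on the planes, so all scalars are
      \<open>1\<close>.\<close>
    case 1
    have sym: "symmetric_endo S"
      unfolding symmetric_endo_def
    proof (intro allI)
      fix x y
      obtain p z where x: "x = p + z" "p \<in> W" "z \<in> K" by (rule decomp)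
      obtain q w where y: "y = q + w" "q \<in> W" "w \<in> K" by (rule decomp)
      have "E z \<bullet> w = z \<bullet> E w"
        using y KEG by (simp add: adj)
      then show "S x \<bullet> y = x \<bullet> S y"
        using x y EK by (simp add: blinfun.add_right SK SW inner_add_left inner_add_right KW)
    qed
    have mem: "e i \<in> W" "f i \<in> W" if "i < m" for i
      unfolding sp[symmetric] using that by (auto intro!: span_base)
    have AB: "A o\<^sub>L endo_inv B = S o\<^sub>L D"
      by (rule blinfun_eqI)
        (simp add: SD E endo_inv_unit_anticommutator[OF B] blinfun.bilinear_simps)
    show ?case
      using on sp a D sym mem SW AB unfolding W_def K_def
      by (intro exI[of _ S] exI[of _ m] exI[of _ e] exI[of _ f] exI[of _ \<alpha>] exI[of _ "\<lambda>_. 1"]) simp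
  next
    case (2 D1)
    then obtain S1 :: "'v endo" and n e' f' \<beta> s where on': "orthonormal_planes n e' f'"
      and sp': "span (e' ` {..<n} \<union> f' ` {..<n}) = W"
      and D1: "rotation_blocks n e' f' \<beta> D1"
      and s: "\<forall>i<n. 0 < s i \<and> S1 (e' i) = s i *\<^sub>R e' i \<and> S1 (f' i) = s i *\<^sub>R f' i"
      and AB: "A o\<^sub>L endo_inv B = S1 o\<^sub>L D1"
      unfolding W_def K_def by (elim exE conjE)
    have SD1: "S1 (D1 x) = E x" for x
    proof -
      have "(A o\<^sub>L endo_inv B) x = (S1 o\<^sub>L D1) x" by (simp only: AB)
      then show ?thesis
        by (simp add: E endo_inv_unit_anticommutator[OF B] blinfun.bilinear_simps)
    qed
    \<comment> \<open>In a competing decomposition \<open>S1\<close> is the scalar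
      \<open>s i\<close> on the plane, hence \<open>E = s i D1\<close> there. Both \<open>E\<close>
      and \<open>D1\<close> preserve norms, so the positive scalar is \<open>1\<close> and
      \<open>D1\<close> agrees with \<open>E\<close>, that is, with \<open>D\<close>.\<close>
    have plane: "D1 v = D v" if "i < n" "v = e' i \<or> v = f' i" for i v
    proof -
      have "S1 (D1 v) = s i *\<^sub>R D1 v"
        using that D1 s
        by (auto simp: rotation_blocks_def blinfun.bilinear_simps scaleR_diff_right scaleR_add_right mult.commute)
      then have Ev: "E v = s i *\<^sub>R D1 v"
        by (simp add: SD1)
      have "norm (E v) = norm v"
        by (simp add: norm_eq_sqrt_inner adj GE)
      moreover have "norm (D1 v) = norm v"
        using rotation_blocks_orthogonal[OF on' D1] by (simp add: orthogonal_endo_iff_norm)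
      moreover have "norm v = 1"
        using that on' by (auto simp: norm_eq_1 orthonormal_planesD)
      ultimately have "s i = 1"
        using Ev s that(1) by (metis abs_of_pos mult.right_neutral norm_scaleR)
      moreover have "v \<in> W"
        unfolding sp'[symmetric] using that by (auto intro!: span_base)
      ultimately show ?thesis
        using Ev DW by simp
    qed
    show ?case
    proof (rule planes_endo_eqI[OF on'])
      \<comment> \<open>The competing planes also span \<open>W\<close>, so vectors orthogonal to
        them lie in \<open>K\<close>, where both maps are the identity.\<close>
      show "D1 z = D z" if "\<forall>i<n. z \<bullet> e' i = 0 \<and> z \<bullet> f' i = 0" for z
        using that D1 DK(1)[OF perp[OF that sp']] by (simp add: rotation_blocks_def)
    qed (use plane in blast)+
  qed
  moreover obtain R where R: "rotation_blocks m e f (\<lambda>i. \<alpha> i / 2) R"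
    using rotation_blocks_exists[OF on] .
  moreover have "rotation_sqrt D = R"
    by (rule rotation_sqrt_eq[OF on a D R])
  ultimately have "rotation_sqrt (rotation_part A B) = R" by simp
  moreover note half = rotation_blocks_half[OF on a D R]
  moreover have "R o\<^sub>L T = T o\<^sub>L R" if T: "T \<in> F" for T
  proof -
    have "T (D x) = D (T x)" for x
    proof -
      obtain p z where x: "x = p + z" "p \<in> W" "z \<in> K" by (rule decomp)
      have "E (T p) = T (E p)"
        using T by (simp add: E AD BD blinfun.bilinear_simps)
      then show ?thesis
        using x T TW TK by (simp add: blinfun.add_right DW DK)
    qed
    from square_root_commutes[OF on a D R this] show ?thesis ..
  qed
  moreover have SS: "S (S x) = x" for x
  proof -
    obtain p z where x: "x = p + z" "p \<in> W" "z \<in> K" by (rule decomp)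
    have "E (E z) = z" using KEG[of z] x EG by metis
    then show ?thesis
      using x EK by (simp add: blinfun.add_right SW SK)
  qed
  have "conj_endo R B = S o\<^sub>L A"
  proof -
    have "D (B (D x)) = B x" for x
    proof -
      obtain p z where x: "x = p + z" "p \<in> W" "z \<in> K" by (rule decomp)
      have "E (B (E p)) = B p"
        by (simp add: E AD BD blinfun.bilinear_simps)
      then show ?thesis
        using x BW BK EW by (simp add: blinfun.add_right DW DK)
    qed
    from square_root_inverts[OF on a D R this] have RBR: "R (B (R x)) = B x" for x
      by (metis blinfun_apply_blinfun_compose)
    \<comment> \<open>\<open>A = E B = S D B\<close>, and \<open>S\<close> is its own
      inverse.\<close>
    have "S (A x) = D (B x)" for x
    proof -
      have "A x = E (B x)"
        by (simp add: E BD blinfun.bilinear_simps)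
      then show ?thesis by (metis SD SS)
    qed
    \<comment> \<open>With \<open>D = R R\<close> and \<open>R B R = B\<close>, the product
      \<open>S A R = D B R\<close> collapses to \<open>R B\<close>.\<close>
    then have "R o\<^sub>L B = (S o\<^sub>L A) o\<^sub>L R"
      by (intro blinfun_eqI) (simp add: RBR flip: half(3))
    then show ?thesis
      using conj_endo_eq_iff[OF half(1)] by blast
  qed
  moreover have "admissible_involution F A S"
    unfolding admissible_involution_def
  proof (intro conjI ballI)
    show "S o\<^sub>L S = id_blinfun"
      by (rule blinfun_eqI) (simp add: SS)
    have "norm (S x) = norm x" for x
    proof -
      obtain p z where x: "x = p + z" "p \<in> W" "z \<in> K" by (rule decomp)
      have "E z \<bullet> E z = z \<bullet> z" by (simp add: adj GE)
      then show ?thesis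
        using x EK
        by (simp add: blinfun.add_right SW SK norm_eq_sqrt_inner inner_add_left inner_add_right KW)
    qed
    then show "orthogonal_endo S"
      by (simp add: orthogonal_endo_iff_norm)
    have comm: "S o\<^sub>L T = T o\<^sub>L S"
      if "\<And>p. p \<in> W \<Longrightarrow> T p \<in> W" "\<And>z. z \<in> K \<Longrightarrow> T z \<in> K" "\<And>z. z \<in> K \<Longrightarrow> E (T z) = T (E z)"
      for T :: "'v endo"
    proof (rule blinfun_eqI)
      fix x
      obtain p z where x: "x = p + z" "p \<in> W" "z \<in> K" by (rule decomp)
      then show "(S o\<^sub>L T) x = (T o\<^sub>L S) x"
        using that by (simp add: blinfun.add_right SW SK)
    qed
    show "S o\<^sub>L A = A o\<^sub>L S"
      by (rule comm) (auto simp: AW AK, simp add: E K blinfun.bilinear_simps)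
    show "S o\<^sub>L T = T o\<^sub>L S" if "T \<in> F" for T
      using that by (intro comm) (auto simp: TW TK, simp add: E AD BD blinfun.bilinear_simps)
  qed
  moreover have "A (B x) = x" if "S x = - x" for x
  proof -
    obtain p z where x: "x = p + z" "p \<in> W" "z \<in> K" by (rule decomp)
    \<comment> \<open>Comparing components shows that \<open>p + p\<close> lies in both
      \<open>W\<close> and \<open>K\<close>; so \<open>p = 0\<close>, and \<open>x = z\<close> is a
      \<open>-1\<close> eigenvector of \<open>E\<close>.\<close>
    have "p + E z = - (p + z)"
      using that x by (simp add: blinfun.add_right SW SK)
    then have "(p + E z) + (p + z) = 0"
      by (simp only: left_minus)
    then have "(p + p) + (z + E z) = 0"
      by (simp add: ac_simps)
    then have eq: "p + p = - (z + E z)"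
      by (rule eq_neg_iff_add_eq_0[THEN iffD2])
    then have "p + p \<in> K"
      using x EK subspace_neg[OF sK] subspace_add[OF sK] by metis
    then have "p + p = 0"
      using W0 x sW subspace_add by blast
    then have "p = 0"
      by (simp flip: scaleR_2)
    with eq x show ?thesis
      by (simp add: E add_eq_0_iff)
  qed
  ultimately show thesis
    using that by blast
qed


section \<open>Deformations and continuous families\<close>

lemma conj_endo_image_adjoin:
  assumes "\<forall>T\<in>F. conj_endo P T = T" "conj_endo P A = B"
  shows "conj_endo P ` adjoin A F = adjoin B F"
proof -
  have adjoin: "adjoin C F = (\<lambda>(c, T). c *\<^sub>R C + T) ` (UNIV \<times> F)" for C :: "'a endo"
    by (auto simp: adjoin_def)
  show ?thesis
    unfolding adjoin image_image using assms
    by (intro image_cong) (auto simp: conj_endo_linear)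
qed

text \<open>On \<open>adjoin A F\<close> both deformations are linear and fix \<open>F\<close>, so
  only the images of \<open>A\<close> have to be matched.\<close>

lemma equivalent_deformations_iff:
  fixes A B C :: "'v::euclidean_space endo"
  assumes F: "subspace F" and A: "unit_anticommutator F A"
  shows "equivalent_deformations F (adjoin A F) (deformation F A B) (deformation F A C) \<longleftrightarrow>
    (\<exists>P. orthogonal_endo P \<and> (\<forall>T\<in>F. conj_endo P T = T) \<and> conj_endo P B = C)"
proof
  assume "equivalent_deformations F (adjoin A F) (deformation F A B) (deformation F A C)"
  then obtain P where P: "orthogonal_endo P" "\<forall>T\<in>F. conj_endo P T = T"
    and eq: "\<forall>T\<in>adjoin A F. conj_endo P (deformation F A B T) = deformation F A C T"
    by (auto simp: equivalent_deformations_def)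
  have "1 *\<^sub>R A + 0 \<in> adjoin A F"
    unfolding adjoin_def using F subspace_0 by blast
  from eq[rule_format, OF this] have "conj_endo P B = C"
    unfolding deformation_eq[OF F A subspace_0[OF F]] by simp
  with P show "\<exists>P. orthogonal_endo P \<and> (\<forall>T\<in>F. conj_endo P T = T) \<and> conj_endo P B = C"
    by blast
next
  assume "\<exists>P. orthogonal_endo P \<and> (\<forall>T\<in>F. conj_endo P T = T) \<and> conj_endo P B = C"
  then show "equivalent_deformations F (adjoin A F) (deformation F A B) (deformation F A C)"
    unfolding equivalent_deformations_def
    by (elim exE, intro exI) (auto simp: adjoin_def deformation_eq[OF F A] conj_endo_linear)
qed

text \<open>On \<open>adjoin A F\<close> the identity is the deformation of \<open>A\<close> to
  itself. Note the direction: the conjugation leads from \<open>B\<close> back to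
  \<open>A\<close>.\<close>

lemma trivial_deformation_iff:
  fixes A B :: "'v::euclidean_space endo"
  assumes F: "subspace F" and A: "unit_anticommutator F A"
  shows "trivial_deformation F A B \<longleftrightarrow>
    (\<exists>P. orthogonal_endo P \<and> (\<forall>T\<in>F. conj_endo P T = T) \<and> conj_endo P B = A)"
proof -
  have "deformation F A A T = T" if "T \<in> adjoin A F" for T
    using that by (auto simp: adjoin_def deformation_eq[OF F A])
  then have "trivial_deformation F A B \<longleftrightarrow>
      equivalent_deformations F (adjoin A F) (deformation F A B) (deformation F A A)"
    by (simp add: trivial_deformation_def equivalent_deformations_def)
  then show ?thesis
    by (simp add: equivalent_deformations_iff[OF F A])
qed

section \<open>Triviality as an equivalence relation\<close>

lemma trivial_deformation_sym:
  fixes A B :: "'v::euclidean_space endo"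
  assumes "subspace F" "unit_anticommutator F A" "unit_anticommutator F B"
    and "trivial_deformation F A B"
  shows "trivial_deformation F B A"
proof -
  obtain P where P: "orthogonal_endo P" "\<forall>T\<in>F. conj_endo P T = T" "conj_endo P B = A"
    using assms trivial_deformation_iff by blast
  then have "orthogonal_endo (endo_inv P)" "\<forall>T\<in>F. conj_endo (endo_inv P) T = T"
    "conj_endo (endo_inv P) A = B"
    using orthogonal_endo_inv conj_endo_inverse by metis+
  then show ?thesis
    using assms trivial_deformation_iff by blast
qed

lemma trivial_deformation_trans:
  fixes A B C :: "'v::euclidean_space endo"
  assumes F: "subspace F" and A: "unit_anticommutator F A" and B: "unit_anticommutator F B"
    and "trivial_deformation F A B" "trivial_deformation F B C"
  shows "trivial_deformation F A C"
proof -
  obtain P Q where "orthogonal_endo P" "\<forall>T\<in>F. conj_endo P T = T" "conj_endo P B = A"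
    "orthogonal_endo Q" "\<forall>T\<in>F. conj_endo Q T = T" "conj_endo Q C = B"
    using assms(4,5) trivial_deformation_iff[OF F A] trivial_deformation_iff[OF F B] by auto
  then have "orthogonal_endo (P o\<^sub>L Q) \<and> (\<forall>T\<in>F. conj_endo (P o\<^sub>L Q) T = T) \<and>
      conj_endo (P o\<^sub>L Q) C = A"
    by (simp add: orthogonal_endo_compose conj_endo_compose)
  then show ?thesis
    unfolding trivial_deformation_iff[OF F A] by blast
qed

text \<open>If \<open>S x = - x\<close> then \<open>A (B x) = x\<close>, so \<open>B x = - A x\<close> and \<open>A - B\<close> stretches \<open>x\<close> by the factor \<open>2\<close>.\<close>

lemma trivial_deformation_close:
  fixes A B :: "'v::euclidean_space endo"
  assumes F: "subspace F" "\<forall>T\<in>F. skew_endo T"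
    and A: "unit_anticommutator F A" and B: "unit_anticommutator F B" and close: "norm (A - B) < 2"
  shows "trivial_deformation F A B"
proof -
  obtain S R where R: "orthogonal_endo R" "\<And>T. T \<in> F \<Longrightarrow> R o\<^sub>L T = T o\<^sub>L R"
    and SR: "conj_endo R B = S o\<^sub>L A" and S: "admissible_involution F A S"
    and neg: "\<And>x. S x = - x \<Longrightarrow> A (B x) = x"
    using rotation_part_conjugates[OF A B F(2)] by metis
  have zero: "x = 0" if "S x = - x" for x
  proof -
    have "A (A (B x)) = A x"
      using neg[OF that] by simp
    then have "B x = - A x"
      by (metis unit_anticommutatorD(2)[OF A] minus_minus)
    then have "(A - B) x = 2 *\<^sub>R A x"
      by (simp add: blinfun.bilinear_simps scaleR_2)
    moreover have "norm (A x) = norm x"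
      by (simp add: norm_eq_sqrt_inner unit_anticommutator_inner[OF A])
    ultimately have "2 * norm x \<le> norm (A - B) * norm x"
      using norm_blinfun[of "A - B" x] by simp
    with close show ?thesis
      using mult_strict_right_mono[OF close, of "norm x"] by fastforce
  qed
  \<comment> \<open>For an involution, \<open>S x - x\<close> is always mapped to its
    negative.\<close>
  have "S x = x" for x
  proof -
    have "S (S x - x) = - (S x - x)"
      using S by (simp add: admissible_involution_iff blinfun.bilinear_simps)
    from zero[OF this] show ?thesis by simp
  qed
  then have "S o\<^sub>L A = A"
    by (intro blinfun_eqI) simp
  then have "orthogonal_endo R \<and> (\<forall>T\<in>F. conj_endo R T = T) \<and> conj_endo R B = A"
    using R SR by (simp add: conj_endo_eq_iff)
  then show ?thesis
    unfolding trivial_deformation_iff[OF F(1) A] by blast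
qed

section \<open>Families over connected parameter sets\<close>

lemma trivial_deformation_connected:
  fixes A :: "'p::topological_space \<Rightarrow> 'v::euclidean_space endo"
  assumes F: "subspace F" "\<forall>T\<in>F. skew_endo T"
    and U: "connected U" "continuous_on U A" "\<forall>u\<in>U. unit_anticommutator F (A u)"
    and uw: "u \<in> U" "w \<in> U"
  shows "trivial_deformation F (A u) (A w)"
proof (rule connected_equivalence_relation[OF U(1) uw, of "\<lambda>u w. trivial_deformation F (A u) (A w)"])
  fix u assume u: "u \<in> U"
  \<comment> \<open>The radius is the bound in \<open>trivial_deformation_close\<close>; thus
    equivalence classes are open in \<open>U\<close>.\<close>
  let ?T = "U \<inter> A -` ball (A u) 2"
  have "openin (top_of_set U) ?T"
    by (rule continuous_openin_preimage_gen[OF U(2)]) simp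
  moreover have "u \<in> ?T" using u by simp
  moreover have "\<forall>w\<in>?T. trivial_deformation F (A u) (A w)"
    using u U(3) by (auto intro!: trivial_deformation_close[OF F] simp: dist_norm)
  ultimately show "\<exists>T. openin (top_of_set U) T \<and> u \<in> T \<and> (\<forall>w\<in>T. trivial_deformation F (A u) (A w))"
    by blast
qed (use U(3) F(1) trivial_deformation_sym trivial_deformation_trans in blast)+


section \<open>Isometries of metric groups\<close>

lemma Ck_map_const: "Ck_map k (\<lambda>p. c)"
  by (induction k arbitrary: c) (auto simp: frechet_derivative_const)

text \<open>A linear map is its own derivative at every point, so its directional derivatives are
  constant.\<close>

lemma smooth_map_linear:
  fixes L :: "'m::euclidean_space \<Rightarrow> 'n::euclidean_space"
  assumes "linear L"
  shows "smooth_map L"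
  unfolding smooth_map_def
proof
  have L: "(L has_derivative L) (at p)" for p
    using assms by (simp add: linear_conv_bounded_linear bounded_linear_imp_has_derivative)
  then have "frechet_derivative L (at p) = L" for p
    by (rule frechet_derivative_at[symmetric])
  then show "Ck_map k L" for k
    using L by (cases k) (auto simp: Ck_map_const differentiable_def assms linear_continuous_on
        linear_conv_bounded_linear[THEN iffD1])
qed

lemma linear_nil_bracket:
  fixes J :: "'z::euclidean_space \<Rightarrow> 'v::euclidean_space endo"
  assumes "linear J"
  shows "linear (nil_bracket J X)"
proof -
  have "linear (\<lambda>Z. J Z X)"
    using assms by (simp add: linear_iff blinfun.add_left blinfun.scaleR_left)
  then show ?thesis
    unfolding nil_bracket_def by (rule adjoint_linear)
qed

text \<open>For fixed \<open>q\<close> the left translation is affine, hence the derivative is the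
  same at every \<open>p\<close>.\<close>

lemma frechet_derivative_nil_mult:
  fixes J :: "'z::euclidean_space \<Rightarrow> 'v::euclidean_space endo"
  assumes "linear J"
  shows "frechet_derivative (nil_mult J q) (at p) =
    (\<lambda>\<xi>. (fst \<xi>, snd \<xi> + (1/2) *\<^sub>R nil_bracket J (fst q) (fst \<xi>)))"
proof -
  have br: "bounded_linear (nil_bracket J (fst q))"
    using linear_nil_bracket[OF assms] by (simp add: linear_conv_bounded_linear)
  have "(nil_mult J q has_derivative (\<lambda>\<xi>. (fst \<xi>, snd \<xi> + (1/2) *\<^sub>R nil_bracket J (fst q) (fst \<xi>)))) (at p)"
    unfolding nil_mult_def
    by (auto intro!: derivative_eq_intros bounded_linear.has_derivative[OF br])
  then show ?thesis
    by (rule frechet_derivative_at[symmetric])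
qed

text \<open>The product map of \<open>Q\<close> and \<open>\<psi>\<close> is orthogonal and carries
  one bracket to the other, so it intertwines the left translations that define the metrics.\<close>

lemma isometric_metric_groupsI:
  fixes J :: "'y::euclidean_space \<Rightarrow> 'v::euclidean_space endo"
    and J' :: "'z::euclidean_space \<Rightarrow> 'v endo"
  assumes J: "linear J" and J': "linear J'" and Q: "orthogonal_endo Q"
    and \<psi>: "linear \<psi>" "bij \<psi>" "\<And>Z. norm (\<psi> Z) = norm Z"
    and intertwine: "\<And>Z. J' (\<psi> Z) = conj_endo Q (J Z)"
  shows "isometric_metric_groups J J'"
  unfolding isometric_metric_groups_def
proof
  define \<phi> where "\<phi> p = (Q (fst p), \<psi> (snd p))" for p
  have Qi: "Q x \<bullet> Q y = x \<bullet> y" for x y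
    using Q by (simp add: orthogonal_endo_iff_inner)
  have \<psi>i: "\<psi> x \<bullet> \<psi> y = x \<bullet> y" for x y
  proof -
    have "(\<psi> x + \<psi> y) \<bullet> (\<psi> x + \<psi> y) = (x + y) \<bullet> (x + y)" "\<psi> x \<bullet> \<psi> x = x \<bullet> x" "\<psi> y \<bullet> \<psi> y = y \<bullet> y"
      using \<psi>(3) by (simp_all add: dot_square_norm flip: linear_add[OF \<psi>(1)])
    then show ?thesis
      by (simp add: inner_add_left inner_add_right inner_commute)
  qed
  have br: "nil_bracket J' (Q X) (Q Y) = \<psi> (nil_bracket J X Y)" for X Y
  proof (rule vector_eq_rdot[THEN iffD1, rule_format])
    fix Z
    obtain V where "Z = \<psi> V"
      using \<psi>(2) by (meson bij_pointE)
    then show "nil_bracket J' (Q X) (Q Y) \<bullet> Z = \<psi> (nil_bracket J X Y) \<bullet> Z"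
      by (simp add: nil_bracket_inner[OF J] nil_bracket_inner[OF J'] intertwine conj_endo_apply
          orthogonal_endo_inv_works[OF Q] Qi \<psi>i)
  qed
  have lin: "linear \<phi>"
    using \<psi>(1) by (auto simp: linear_iff \<phi>_def blinfun.bilinear_simps)
  have bij: "bij \<phi>"
  proof -
    have "\<phi> = map_prod Q \<psi>"
      by (auto simp: \<phi>_def)
    then show ?thesis
      using bij_orthogonal_endo[OF Q] \<psi>(2) by (simp add: bij_def prod.inj_map map_prod_surj)
  qed
  have "linear (inv \<phi>)"
    by (rule linearI; rule injD[OF bij_is_inj[OF bij]])
       (simp_all add: surj_f_inv_f[OF bij_is_surj[OF bij]] linear_add[OF lin] linear_scale[OF lin])
  have d\<phi>: "frechet_derivative \<phi> (at p) = \<phi>" for p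
    using lin bounded_linear_imp_has_derivative frechet_derivative_at linear_conv_bounded_linear
    by metis
  \<comment> \<open>The differentiated form of the fact that \<open>\<phi>\<close> intertwines left
    translations, \<open>\<phi>\<close> being its own derivative.\<close>
  have metric: "frechet_derivative (nil_mult J' (- \<phi> p)) (at (\<phi> p)) (\<phi> \<xi>) =
      \<phi> (frechet_derivative (nil_mult J (- p)) (at p) \<xi>)" for p \<xi>
  proof -
    have "- Q (fst p) = Q (- fst p)"
      by (simp add: blinfun.bilinear_simps)
    then show ?thesis
      by (simp add: frechet_derivative_nil_mult[OF J] frechet_derivative_nil_mult[OF J'] \<phi>_def br
          linear_add[OF \<psi>(1)] linear_scale[OF \<psi>(1)])
  qed
  have "\<phi> \<xi> \<bullet> \<phi> \<eta> = \<xi> \<bullet> \<eta>" for \<xi> \<eta>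
    by (simp add: \<phi>_def inner_prod_def Qi \<psi>i)
  then show "riemannian_isometry (left_invariant_metric J) (left_invariant_metric J') \<phi>"
    using bij smooth_map_linear[OF lin] smooth_map_linear[OF \<open>linear (inv \<phi>)\<close>]
    by (simp add: riemannian_isometry_def left_invariant_metric_def d\<phi> metric)
qed

section \<open>Traces and the natural norm\<close>

lemma endo_trace_commute:
  fixes T U :: "'v::euclidean_space endo"
  shows "endo_trace (T o\<^sub>L U) = endo_trace (U o\<^sub>L T)"
proof -
  have expand: "endo_trace (T o\<^sub>L U) = (\<Sum>b\<in>Basis. \<Sum>c\<in>Basis. (U b \<bullet> c) * (T c \<bullet> b))"
    for T U :: "'v endo"
  proof -
    have "T (U b) \<bullet> b = (\<Sum>c\<in>Basis. (U b \<bullet> c) * (T c \<bullet> b))" for b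
    proof -
      have "T (U b) = T (\<Sum>c\<in>Basis. (U b \<bullet> c) *\<^sub>R c)"
        by (simp add: euclidean_representation)
      then show ?thesis
        by (simp only: blinfun.sum_right blinfun.scaleR_right inner_sum_left inner_scaleR_left)
    qed
    then show ?thesis
      by (simp add: endo_trace_def)
  qed
  show ?thesis
    unfolding expand by (subst sum.swap) (simp add: mult.commute)
qed

lemma endo_trace_conj:
  fixes T :: "'v::euclidean_space endo"
  assumes "orthogonal_endo P"
  shows "endo_trace (conj_endo P T) = endo_trace T"
proof -
  have "endo_trace (conj_endo P T) = endo_trace (endo_inv P o\<^sub>L (P o\<^sub>L T))"
    unfolding conj_endo_def by (rule endo_trace_commute)
  also have "endo_inv P o\<^sub>L (P o\<^sub>L T) = T"
    by (rule blinfun_eqI) (simp add: orthogonal_endo_inv_works[OF assms])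
  finally show ?thesis .
qed

text \<open>The natural norm comes from a trace, which conjugation preserves, so the map
  \<open>\<psi>\<close> induced between the parameter spaces is automatically isometric.\<close>

lemma isometric_metric_groups_natural_norm:
  fixes J :: "'y::euclidean_space \<Rightarrow> 'v::euclidean_space endo"
    and J' :: "'z::euclidean_space \<Rightarrow> 'v endo"
  assumes J: "parametrizes J X" "natural_norm J" and J': "parametrizes J' Y" "natural_norm J'"
    and Q: "orthogonal_endo Q" "conj_endo Q ` X = Y"
  shows "isometric_metric_groups J J'"
proof -
  have lin: "linear J" "linear J'" and inj: "inj J" "inj J'"
    and ran: "range J = X" "range J' = Y"
    using J J' by (auto simp: parametrizes_def)
  define \<psi> where "\<psi> Z = inv J' (conj_endo Q (J Z))" for Z
  have J\<psi>: "J' (\<psi> Z) = conj_endo Q (J Z)" for Z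
    unfolding \<psi>_def using ran Q(2) by (intro f_inv_into_f) auto
  have inv: "conj_endo (endo_inv Q) (conj_endo Q T) = T" for T
    by (rule conj_endo_inverse[OF Q(1)])
  have "linear \<psi>"
    by (rule linearI; rule injD[OF inj(2)])
       (simp_all add: J\<psi> linear_add[OF lin(1)] linear_add[OF lin(2)] linear_scale[OF lin(1)]
          linear_scale[OF lin(2)] conj_endo_linear)
  moreover have "bij \<psi>"
  proof (rule bijI)
    show "inj \<psi>"
      using J\<psi> inv inj(1) by (metis injD injI)
    show "surj \<psi>"
    proof (rule surjI)
      fix V
      have "J' V \<in> conj_endo Q ` range J"
        using ran Q(2) by auto
      then obtain Z where "J' V = conj_endo Q (J Z)" by auto
      then have "V = \<psi> Z"
        using J\<psi> inj(2) by (metis injD)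
      then show "\<psi> (SOME Z. \<psi> Z = V) = V"
        by (metis (mono_tags) someI_ex)
    qed
  qed
  moreover have "norm (\<psi> Z) = norm Z" for Z
  proof -
    have "conj_endo Q (J Z) o\<^sub>L conj_endo Q (J Z) = conj_endo Q (J Z o\<^sub>L J Z)"
      by (rule blinfun_eqI) (simp add: conj_endo_apply orthogonal_endo_inv_works[OF Q(1)])
    then have "(norm (\<psi> Z))\<^sup>2 = (norm Z)\<^sup>2"
      using J(2) J'(2) by (simp add: natural_norm_def J\<psi> endo_trace_conj[OF Q(1)])
    then show ?thesis by simp
  qed
  ultimately show ?thesis
    using isometric_metric_groupsI[OF lin Q(1)] J\<psi> by blast
qed

text \<open>Isometry is claimed for two choices of the inner product on the centre: the one carried
  over by the deformation, with a common parameter space, and the natural one, where the two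
  parameter spaces may differ.\<close>

theorem theorem2p2:
  fixes s :: nat
    and Fgen :: "nat \<Rightarrow> 'v::euclidean_space endo"
    and F :: "'v endo set"
  assumes F_skew: "\<forall>i\<in>{1..s}. skew_endo (Fgen i)"
    and F_span: "F = span (Fgen ` {1..s})"
  shows
    "(\<forall>A0 B0. unit_anticommutator F A0 \<and> unit_anticommutator F B0 \<longrightarrow>
        (let R = rotation_sqrt (rotation_part A0 B0) in
           orthogonal_endo R \<and>
           unit_anticommutator F (conj_endo R B0) \<and>
           sigma_deformation_of F A0 (conj_endo R B0)) \<and>
        (\<not> trivial_deformation F A0 B0 \<longrightarrow>
           (\<exists>\<sigma>. admissible_involution F A0 \<sigma> \<and> \<sigma> \<noteq> id_blinfun \<and>
                equivalent_deformations F (adjoin A0 F)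
                  (deformation F A0 B0) (deformation F A0 (\<sigma> o\<^sub>L A0))))) \<and>
     (\<forall>(U :: 'p::topological_space set) (A :: 'p \<Rightarrow> 'v endo).
        connected U \<and> continuous_on U A \<and> (\<forall>u\<in>U. unit_anticommutator F (A u)) \<longrightarrow>
        (\<forall>u\<in>U. \<forall>w\<in>U.
           trivial_deformation F (A u) (A w) \<and>
           (\<exists>P. orthogonal_endo P \<and> conj_endo P ` adjoin (A u) F = adjoin (A w) F) \<and>
           (\<forall>J :: 'z::euclidean_space \<Rightarrow> 'v endo. parametrizes J (adjoin (A u) F) \<longrightarrow>
              isometric_metric_groups J (deformation F (A u) (A w) \<circ> J)) \<and>
           (\<forall>(J :: 'y::euclidean_space \<Rightarrow> 'v endo) (J' :: 'z \<Rightarrow> 'v endo).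
              parametrizes J (adjoin (A u) F) \<and> natural_norm J \<and>
              parametrizes J' (adjoin (A w) F) \<and> natural_norm J' \<longrightarrow>
              isometric_metric_groups J J')))"
proof -
  have F: "subspace F"
    by (simp add: F_span)
  have "subspace {T :: 'v endo. skew_endo T}"
    by (auto simp: subspace_def skew_endo_def blinfun.bilinear_simps inner_add_left inner_add_right)
  then have skew: "\<forall>T\<in>F. skew_endo T"
    unfolding F_span using F_skew span_minimal[of "Fgen ` {1..s}" "{T. skew_endo T}"] by blast

  have part1: "(let R = rotation_sqrt (rotation_part A0 B0) in
           orthogonal_endo R \<and>
           unit_anticommutator F (conj_endo R B0) \<and>
           sigma_deformation_of F A0 (conj_endo R B0)) \<and>
        (\<not> trivial_deformation F A0 B0 \<longrightarrow>
           (\<exists>\<sigma>. admissible_involution F A0 \<sigma> \<and> \<sigma> \<noteq> id_blinfun \<and>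
                equivalent_deformations F (adjoin A0 F)
                  (deformation F A0 B0) (deformation F A0 (\<sigma> o\<^sub>L A0))))"
    if A: "unit_anticommutator F A0" and B: "unit_anticommutator F B0" for A0 B0
  proof -
    obtain S R where R: "rotation_sqrt (rotation_part A0 B0) = R" "orthogonal_endo R"
      "\<And>T. T \<in> F \<Longrightarrow> R o\<^sub>L T = T o\<^sub>L R" and SR: "conj_endo R B0 = S o\<^sub>L A0"
      and S: "admissible_involution F A0 S"
      using rotation_part_conjugates[OF A B skew] by metis
    have RF: "\<forall>T\<in>F. conj_endo R T = T"
      using R by (simp add: conj_endo_eq_iff)
    \<comment> \<open>With \<open>S = id\<close> the root \<open>R\<close> itself would carry
      \<open>B0\<close> to \<open>A0\<close>.\<close>
    have "S \<noteq> id_blinfun" if "\<not> trivial_deformation F A0 B0"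
    proof
      assume "S = id_blinfun"
      then have "conj_endo R B0 = A0"
        unfolding SR by (auto intro: blinfun_eqI)
      with that show False
        using R RF trivial_deformation_iff[OF F A] by blast
    qed
    moreover have "equivalent_deformations F (adjoin A0 F)
        (deformation F A0 B0) (deformation F A0 (S o\<^sub>L A0))"
      using R RF SR equivalent_deformations_iff[OF F A] by blast
    moreover have "sigma_deformation_of F A0 (S o\<^sub>L A0)"
      using S sigma_deformation_of_def by blast
    ultimately show ?thesis
      using S R(2) unit_anticommutator_involution[OF A S] by (auto simp: Let_def R(1) SR)
  qed

  have part2: "trivial_deformation F (A u) (A w) \<and>
      (\<exists>P. orthogonal_endo P \<and> conj_endo P ` adjoin (A u) F = adjoin (A w) F) \<and>
      (\<forall>J :: 'z \<Rightarrow> 'v endo. parametrizes J (adjoin (A u) F) \<longrightarrow>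
         isometric_metric_groups J (deformation F (A u) (A w) \<circ> J)) \<and>
      (\<forall>(J :: 'y \<Rightarrow> 'v endo) (J' :: 'z \<Rightarrow> 'v endo).
         parametrizes J (adjoin (A u) F) \<and> natural_norm J \<and>
         parametrizes J' (adjoin (A w) F) \<and> natural_norm J' \<longrightarrow>
         isometric_metric_groups J J')"
    if U: "connected U" "continuous_on U A" "\<forall>u\<in>U. unit_anticommutator F (A u)"
      and uw: "u \<in> U" "w \<in> U"
    for U and A :: "'p \<Rightarrow> 'v endo" and u w
  proof -
    have Au: "unit_anticommutator F (A u)" and Aw: "unit_anticommutator F (A w)"
      using U uw by auto
    have triv: "trivial_deformation F (A u) (A w)"
      by (rule trivial_deformation_connected[OF F skew U uw])
    \<comment> \<open>The order is reversed because \<open>trivial_deformation_iff\<close>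
      conjugates the second endomorphism to the first, and a conjugation from \<open>A u\<close> to
      \<open>A w\<close> is wanted.\<close>
    then have "trivial_deformation F (A w) (A u)"
      by (rule trivial_deformation_sym[OF F Au Aw])
    then obtain P where P: "orthogonal_endo P" "\<forall>T\<in>F. conj_endo P T = T" "conj_endo P (A u) = A w"
      unfolding trivial_deformation_iff[OF F Aw] by blast
    have img: "conj_endo P ` adjoin (A u) F = adjoin (A w) F"
      by (rule conj_endo_image_adjoin[OF P(2,3)])
    have "isometric_metric_groups J (deformation F (A u) (A w) \<circ> J)"
      if J: "parametrizes J (adjoin (A u) F)" for J :: "'z \<Rightarrow> 'v endo"
    proof -
      have lin: "linear J" and ran: "range J = adjoin (A u) F"
        using J by (auto simp: parametrizes_def)
      \<comment> \<open>The deformation acts as conjugation by \<open>P\<close>, so the identity of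
        the common parameter space serves as \<open>\<psi>\<close>.\<close>
      have "deformation F (A u) (A w) T = conj_endo P T" if "T \<in> adjoin (A u) F" for T
        using that P by (auto simp: adjoin_def deformation_eq[OF F Au] conj_endo_linear)
      then have J': "deformation F (A u) (A w) \<circ> J = (\<lambda>Z. conj_endo P (J Z))"
        using ran by (auto simp: fun_eq_iff)
      have "linear (\<lambda>Z. conj_endo P (J Z))"
        by (rule linearI) (simp_all add: linear_add[OF lin] linear_scale[OF lin] conj_endo_linear)
      then show ?thesis
        unfolding J' using isometric_metric_groupsI[OF lin _ P(1), of _ "\<lambda>Z. Z"]
        by (simp add: linear_id[unfolded id_def] bij_id[unfolded id_def])
    qed
    moreover have "isometric_metric_groups J J'"
      if "parametrizes J (adjoin (A u) F)" "natural_norm J"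
        "parametrizes J' (adjoin (A w) F)" "natural_norm J'"
      for J :: "'y \<Rightarrow> 'v endo" and J' :: "'z \<Rightarrow> 'v endo"
      by (rule isometric_metric_groups_natural_norm[OF that P(1) img])
    ultimately show ?thesis
      using triv P(1) img by blast
  qed

  show ?thesis
    by (rule conjI; intro allI impI ballI; elim conjE; rule part1 part2; assumption)
qed

end
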